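(* Let $K$ be a field, let $k\ge 2$ be an integer, and let $a,d\in\mathbb{N}^2$ be linearly independent over $\mathbb{Q}$ such that $\{a,a+d,\ldots,a+kd\}$ is a minimal generating set of $S_{a,d,k}=\langle a,a+d,\ldots,a+kd\rangle$. Then the Castelnuovo-Mumford regularity of the defining ideal $I_{S_{a,d,k}}$ (with respect to the standard grading on $K[x_1,\ldots,x_{k+1}]$) is $\mathrm{reg}(I_{S_{a,d,k}})=2$.
   Context: $\mathbb{N}$ denotes the set of non-negative integers. $\langle a_1,\ldots,a_n\rangle=\{\sum_i\lambda_i a_i\mid \lambda_i\in\mathbb{N}\}$ is the affine semigroup generated by $a_1,\ldots,a_n\in\mathbb{N}^r$. $K[S]=\bigoplus_{s\in S}K\mathbf{t}^s\subseteq K[t_1,\ldots,t_r]$ is the semigroup ring of $S$. The defining ideal $I_{S_{a,d,k}}$ is the kernel of the $K$-algebra homomorphism $K[x_1,\ldots,x_{k+1}]\to K[S_{a,d,k}]$, $x_i\mapsto\mathbf{t}^{a+(i-1)d}$; it is homogeneous for the standard grading $\deg x_i=1$. For a homogeneous ideal $I$ of $K[x_1,\ldots,x_n]$, $\mathrm{reg}(I)=\max_{0\le i\le n-2}\{t_i-i\}$, where $t_i$ is the maximum degree of the minimal $i$-syzygies of $I$ (minimal generators being the $0$-syzygies). *)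

theory Defs
  imports "HOL-Analysis.Analysis" "HOL-Library.Poly_Mapping"
begin

text \<open>The semigroup generated by a finite set \<open>A\<close> of vectors in \<open>\<nat>\<^sup>r\<close>.\<close>

definition affine_semigroup :: "(nat ^ 'r) set \<Rightarrow> (nat ^ 'r) set" where
  "affine_semigroup A = {\<Sum>x\<in>A. c x *s x | c. True}"

definition minimal_generating_set :: "(nat ^ 'r) set \<Rightarrow> (nat ^ 'r) set \<Rightarrow> bool" where
  "minimal_generating_set A S \<longleftrightarrow>
     affine_semigroup A = S \<and> (\<forall>B. B \<subset> A \<longrightarrow> affine_semigroup B \<noteq> S)"

definition rat_vec :: "nat ^ 'r \<Rightarrow> rat ^ 'r" where
  "rat_vec a = (\<chi> i. of_nat (a $ i))"

text \<open>The inequality is needed because \<^const>\<open>vec.dependent\<close> is a predicate on sets,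
  whereas linear independence of \<open>a, d\<close> is meant for the pair.\<close>

definition lin_indep_over_rat :: "nat ^ 'r \<Rightarrow> nat ^ 'r \<Rightarrow> bool" where
  "lin_indep_over_rat a d \<longleftrightarrow> a \<noteq> d \<and> vec.independent {rat_vec a, rat_vec d}"

definition arith_gens :: "nat ^ 'r \<Rightarrow> nat ^ 'r \<Rightarrow> nat \<Rightarrow> (nat ^ 'r) set" where
  "arith_gens a d k = (\<lambda>i. a + i *s d) ` {0..k}"

definition arith_semigroup :: "nat ^ 'r \<Rightarrow> nat ^ 'r \<Rightarrow> nat \<Rightarrow> (nat ^ 'r) set" where
  "arith_semigroup a d k = affine_semigroup (arith_gens a d k)"

text \<open>An exponent vector \<open>m\<close> stands for the monomial \<open>\<Prod>i. x\<^sub>i ^ m i\<close>, and \<open>poly_ring n\<close> is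
  \<open>K[x\<^sub>1, \<dots>, x\<^sub>n]\<close> inside the ring of polynomials in the variables \<open>x\<^sub>0, x\<^sub>1, x\<^sub>2, \<dots>\<close>.
  Likewise \<open>(nat ^ 'r) \<Rightarrow>\<^sub>0 'k\<close> is the polynomial ring \<open>K[t\<^sub>1, \<dots>, t\<^sub>r]\<close>, in which
  \<open>t\<^sup>s\<close> is \<open>Poly_Mapping.single s 1\<close>.\<close>

type_synonym 'k mpol = "(nat \<Rightarrow>\<^sub>0 nat) \<Rightarrow>\<^sub>0 'k"

definition poly_ring :: "nat \<Rightarrow> 'k::field mpol set" where
  "poly_ring n = {p. \<forall>m\<in>Poly_Mapping.keys p. Poly_Mapping.keys m \<subseteq> {1..n}}"

definition mono_deg :: "(nat \<Rightarrow>\<^sub>0 nat) \<Rightarrow> nat" where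
  "mono_deg m = (\<Sum>i\<in>Poly_Mapping.keys m. Poly_Mapping.lookup m i)"

text \<open>The value at \<open>p\<close> of the \<open>K\<close>-algebra homomorphism with \<open>x\<^sub>i \<mapsto> f i\<close>;
  \<open>Poly_Mapping.single 0\<close> embeds the constants.\<close>

definition poly_subst :: "(nat \<Rightarrow> (nat ^ 'r) \<Rightarrow>\<^sub>0 'k::field) \<Rightarrow> 'k mpol \<Rightarrow> (nat ^ 'r) \<Rightarrow>\<^sub>0 'k" where
  "poly_subst f p =
     (\<Sum>m\<in>Poly_Mapping.keys p. Poly_Mapping.single 0 (Poly_Mapping.lookup p m) *
        (\<Prod>i\<in>Poly_Mapping.keys m. f i ^ Poly_Mapping.lookup m i))"

text \<open>The image of the homomorphism lies in \<open>K[S] \<subseteq> K[t\<^sub>1, \<dots>, t\<^sub>r]\<close>, so the kernel can be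
  computed in \<open>K[t\<^sub>1, \<dots>, t\<^sub>r]\<close>.\<close>

definition defining_ideal :: "nat ^ 'r \<Rightarrow> nat ^ 'r \<Rightarrow> nat \<Rightarrow> 'k::field mpol set" where
  "defining_ideal a d k =
     {p \<in> poly_ring (k + 1).
        poly_subst (\<lambda>i. Poly_Mapping.single (a + (i - 1) *s d) 1) p = 0}"

text \<open>Write \<open>R = poly_ring n\<close>. An element of a free module \<open>R\<^sup>b\<close> is a function \<open>nat \<Rightarrow> 'k mpol\<close>
  with values in \<open>R\<close> that vanishes at all indices \<open>\<ge> b\<close>. A grading of \<open>R\<^sup>b\<close> is a function
  \<open>e :: nat \<Rightarrow> nat\<close>, where \<open>e l\<close> is the degree of the \<open>l\<close>-th basis vector.\<close>

definition homogeneous_vec :: "(nat \<Rightarrow> nat) \<Rightarrow> nat \<Rightarrow> (nat \<Rightarrow> 'k::field mpol) \<Rightarrow> bool" where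
  "homogeneous_vec e D v \<longleftrightarrow> (\<forall>l. \<forall>m\<in>Poly_Mapping.keys (v l). mono_deg m + e l = D)"

definition poly_span :: "nat \<Rightarrow> nat set \<Rightarrow> (nat \<Rightarrow> nat \<Rightarrow> 'k::field mpol) \<Rightarrow> (nat \<Rightarrow> 'k mpol) set" where
  "poly_span n J g = {\<lambda>l. \<Sum>j\<in>J. c j * g j l | c. \<forall>j\<in>J. c j \<in> poly_ring n}"

text \<open>\<open>g 0, \<dots>, g (b - 1)\<close> is a minimal system of homogeneous generators, of degrees
  \<open>e' 0, \<dots>, e' (b - 1)\<close>, of the submodule \<open>M\<close> of a free module graded by \<open>e\<close>.\<close>

definition minimal_hom_generators ::
  "nat \<Rightarrow> (nat \<Rightarrow> nat) \<Rightarrow> (nat \<Rightarrow> 'k::field mpol) set \<Rightarrow>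
   nat \<Rightarrow> (nat \<Rightarrow> nat) \<Rightarrow> (nat \<Rightarrow> nat \<Rightarrow> 'k mpol) \<Rightarrow> bool" where
  "minimal_hom_generators n e M b e' g \<longleftrightarrow>
     (\<forall>j<b. homogeneous_vec e (e' j) (g j)) \<and>
     poly_span n {..<b} g = M \<and>
     (\<forall>J. J \<subset> {..<b} \<longrightarrow> poly_span n J g \<noteq> M)"

definition syzygy_module ::
  "nat \<Rightarrow> nat \<Rightarrow> (nat \<Rightarrow> nat \<Rightarrow> 'k::field mpol) \<Rightarrow> (nat \<Rightarrow> 'k mpol) set" where
  "syzygy_module n b g =
     {c. (\<forall>j. c j \<in> poly_ring n) \<and> (\<forall>j\<ge>b. c j = 0) \<and> (\<forall>l. (\<Sum>j<b. c j * g j l) = 0)}"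

definition ideal_module :: "'k::field mpol set \<Rightarrow> (nat \<Rightarrow> 'k mpol) set" where
  "ideal_module I = {v. v 0 \<in> I \<and> (\<forall>l>0. v l = 0)}"

text \<open>A minimal graded free resolution
  \<open>\<dots> \<rightarrow> F\<^sub>1 \<rightarrow> F\<^sub>0 \<rightarrow> I \<rightarrow> 0\<close>: the module \<open>F\<^sub>i\<close> has rank \<open>\<beta> i\<close>, its \<open>j\<close>-th basis vector has
  degree \<open>e i j\<close> and is mapped to \<open>g i j\<close>. So the \<open>g 0 j\<close> are minimal generators of \<open>I\<close>, and
  the \<open>g i j\<close> are the minimal \<open>i\<close>-syzygies of \<open>I\<close>.\<close>

definition minimal_graded_resolution ::
  "nat \<Rightarrow> 'k::field mpol set \<Rightarrow>
   (nat \<Rightarrow> nat) \<Rightarrow> (nat \<Rightarrow> nat \<Rightarrow> nat) \<Rightarrow> (nat \<Rightarrow> nat \<Rightarrow> nat \<Rightarrow> 'k mpol) \<Rightarrow> bool" where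
  "minimal_graded_resolution n I \<beta> e g \<longleftrightarrow>
     minimal_hom_generators n (\<lambda>_. 0) (ideal_module I) (\<beta> 0) (e 0) (g 0) \<and>
     (\<forall>i. minimal_hom_generators n (e i) (syzygy_module n (\<beta> i) (g i))
            (\<beta> (Suc i)) (e (Suc i)) (g (Suc i)))"

text \<open>\<open>max (t\<^sub>i - i)\<close> over \<open>0 \<le> i \<le> n - 2\<close>, where \<open>t\<^sub>i\<close> is the maximal degree of a minimal
  \<open>i\<close>-syzygy; indices \<open>i\<close> without any minimal syzygy do not contribute.\<close>

definition resolution_regularity :: "nat \<Rightarrow> (nat \<Rightarrow> nat) \<Rightarrow> (nat \<Rightarrow> nat \<Rightarrow> nat) \<Rightarrow> int" where
  "resolution_regularity n \<beta> e =
     Max {int (Max (e i ` {..<\<beta> i})) - int i | i. i + 2 \<le> n \<and> \<beta> i > 0}"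

text \<open>Minimal graded free resolutions of a homogeneous ideal \<open>I\<close> of \<open>poly_ring n\<close> exist and are
  unique up to graded isomorphism, so the degrees in them depend on \<open>I\<close> only.\<close>

definition regularity :: "nat \<Rightarrow> 'k::field mpol set \<Rightarrow> int" where
  "regularity n I =
     (THE r. \<exists>\<beta> e g. minimal_graded_resolution n I \<beta> e g \<and> r = resolution_regularity n \<beta> e)"

end

theory Submission
  imports Defs
begin

text \<open>
  A monomial \<open>m\<close> is mapped to \<open>t\<close> to the power \<open>D a + w d\<close>, where \<open>D\<close> is its degree and
  \<open>w = \<Sum>i. (i - 1) m\<^sub>i\<close> its weight. As \<open>a\<close> and \<open>d\<close> are linearly independent, two monomials have the
  same image iff degree and weight agree, so the defining ideal \<open>I\<close> is the ideal of the rational normal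
  curve of degree \<open>k\<close> (\<open>defining_ideal_eq_curve_ideal\<close>). It remains to show that \<open>I\<close> is generated by
  quadrics and has a linear resolution.

  The first and the last variable form a regular sequence on \<open>R / I\<close>, where \<open>R\<close> is the polynomial ring.
  Modulo these two parameters, \<open>I\<close> becomes the ideal generated by all products \<open>x\<^sub>i x\<^sub>j\<close> of inner
  variables, which has linear quotients: if these products are listed by increasing \<open>j \<ge> i\<close>, the colon
  ideal of the predecessors by \<open>x\<^sub>i x\<^sub>j\<close> is generated by the inner variables of index less than \<open>j\<close>
  (\<open>pair_colon\<close>). This combination, regular parameters together with linear quotients modulo the
  parameters, is the notion \<open>linear_module\<close>; \<open>linear_module_curve_ideal\<close> establishes it for \<open>I\<close>.

  The point of the notion is that it passes to syzygies, with linear generators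
  (\<open>linear_module_syzygies\<close>). The coordinate at the last generator involved in a syzygy
  ranges over a colon ideal; this ideal is generated by variables, and such an ideal has linear quotients
  itself. Regularity of the parameters allows relations to be lifted from the reduction modulo
  the parameters to \<open>R\<close>.

  Minimal generators of a linear module are unique up to an invertible scalar matrix
  (\<open>change_of_minimal_generators\<close>). Hence the induction along a resolution applies to every minimal
  graded resolution: all generators in step \<open>i\<close> have degree \<open>i + 2\<close>, and the regularity is \<open>2\<close>
  (\<open>linear_ideal_regularity\<close>).
\<close>

section \<open>Polynomials with prescribed monomials\<close>

text \<open>The polynomial ring, its homogeneous components and its monomial ideals are all of this
  form, so their closure properties need only one proof.\<close>

definition monomial_span :: "nat \<Rightarrow> ((nat \<Rightarrow>\<^sub>0 nat) \<Rightarrow> bool) \<Rightarrow> 'k::field mpol set" where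
  "monomial_span n P = {p \<in> poly_ring n. \<forall>m\<in>Poly_Mapping.keys p. P m}"

definition restrict_monomials :: "((nat \<Rightarrow>\<^sub>0 nat) \<Rightarrow> bool) \<Rightarrow> 'k::field mpol \<Rightarrow> 'k mpol" where
  "restrict_monomials P p =
     (\<Sum>m\<in>{m\<in>Poly_Mapping.keys p. P m}. Poly_Mapping.single m (Poly_Mapping.lookup p m))"

lemma lookup_restrict_monomials:
  "Poly_Mapping.lookup (restrict_monomials P p) m = (Poly_Mapping.lookup p m when P m)"
proof -
  have "Poly_Mapping.lookup (restrict_monomials P p) m =
      (\<Sum>m'\<in>{m\<in>Poly_Mapping.keys p. P m}. if m' = m then Poly_Mapping.lookup p m' else 0)"
    unfolding restrict_monomials_def lookup_sum
    by (intro sum.cong) (auto simp: lookup_single when_def)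
  also have "\<dots> = (Poly_Mapping.lookup p m when P m)"
    by (auto simp: when_def in_keys_iff)
  finally show ?thesis .
qed

lemma keys_restrict_monomials:
  "Poly_Mapping.keys (restrict_monomials P p) = {m\<in>Poly_Mapping.keys p. P m}"
  by (auto simp: in_keys_iff lookup_restrict_monomials when_def split: if_splits)

lemma restrict_monomials_add:
  "restrict_monomials P (p + q) = restrict_monomials P p + restrict_monomials P q"
  by (rule poly_mapping_eqI) (simp add: lookup_restrict_monomials lookup_add when_def)

lemma restrict_monomials_diff:
  "restrict_monomials P (p - q) = restrict_monomials P p - restrict_monomials P q"
  by (rule poly_mapping_eqI) (simp add: lookup_restrict_monomials lookup_minus when_def)

lemma restrict_monomials_0 [simp]: "restrict_monomials P 0 = 0"
  by (rule poly_mapping_eqI) (simp add: lookup_restrict_monomials when_def)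

lemma restrict_monomials_sum:
  "restrict_monomials P (\<Sum>i\<in>A. f i) = (\<Sum>i\<in>A. restrict_monomials P (f i))"
  by (induction A rule: infinite_finite_induct) (auto simp: restrict_monomials_add)

lemma restrict_monomials_split:
  "p = restrict_monomials P p + restrict_monomials (\<lambda>m. \<not> P m) p"
  by (rule poly_mapping_eqI) (simp add: lookup_restrict_monomials lookup_add when_def)

lemma restrict_monomials_id:
  "(\<And>m. m \<in> Poly_Mapping.keys p \<Longrightarrow> P m) \<Longrightarrow> restrict_monomials P p = p"
  by (rule poly_mapping_eqI) (auto simp: lookup_restrict_monomials when_def in_keys_iff)

lemma restrict_monomials_eq_0:
  "(\<And>m. m \<in> Poly_Mapping.keys p \<Longrightarrow> \<not> P m) \<Longrightarrow> restrict_monomials P p = 0"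
  by (rule poly_mapping_eqI) (auto simp: lookup_restrict_monomials when_def in_keys_iff)

lemma monomial_span_poly_ring: "p \<in> monomial_span n P \<Longrightarrow> p \<in> poly_ring n"
  by (simp add: monomial_span_def)

lemma monomial_span_mono:
  "p \<in> monomial_span n P \<Longrightarrow> (\<And>m. P m \<Longrightarrow> Q m) \<Longrightarrow> p \<in> monomial_span n Q"
  by (auto simp: monomial_span_def)

lemma poly_ring_eq_monomial_span: "poly_ring n = monomial_span n (\<lambda>_. True)"
  by (simp add: monomial_span_def)

lemma monomial_span_0 [simp]: "0 \<in> monomial_span n P"
  by (simp add: monomial_span_def poly_ring_def)

lemma monomial_span_add:
  "p \<in> monomial_span n P \<Longrightarrow> q \<in> monomial_span n P \<Longrightarrow> p + q \<in> monomial_span n P"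
  using Poly_Mapping.keys_add[of p q] by (fastforce simp: monomial_span_def poly_ring_def)

lemma monomial_span_uminus: "p \<in> monomial_span n P \<Longrightarrow> - p \<in> monomial_span n P"
  by (auto simp: monomial_span_def poly_ring_def in_keys_iff)

lemma monomial_span_diff:
  "p \<in> monomial_span n P \<Longrightarrow> q \<in> monomial_span n P \<Longrightarrow> p - q \<in> monomial_span n P"
  using monomial_span_add[of p n P "- q"] monomial_span_uminus[of q n P] by simp

lemma monomial_span_sum:
  "(\<And>i. i \<in> A \<Longrightarrow> f i \<in> monomial_span n P) \<Longrightarrow> (\<Sum>i\<in>A. f i) \<in> monomial_span n P"
  by (induction A rule: infinite_finite_induct) (auto intro: monomial_span_add)

lemma keys_add_nat: "Poly_Mapping.keys (a + b :: nat \<Rightarrow>\<^sub>0 nat) = Poly_Mapping.keys a \<union> Poly_Mapping.keys b"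
  by (auto simp: in_keys_iff lookup_add)

lemma monomial_span_mult:
  assumes "p \<in> monomial_span n P" "q \<in> monomial_span n Q" "\<And>a b. P a \<Longrightarrow> Q b \<Longrightarrow> T (a + b)"
  shows "p * q \<in> monomial_span n T"
proof -
  have "Poly_Mapping.keys m \<subseteq> {1..n} \<and> T m" if m: "m \<in> Poly_Mapping.keys (p * q)" for m
  proof -
    obtain a b where ab: "m = a + b" "a \<in> Poly_Mapping.keys p" "b \<in> Poly_Mapping.keys q"
      using subsetD[OF keys_mult m] by auto
    then show ?thesis
      using assms by (auto simp: monomial_span_def poly_ring_def keys_add_nat)
  qed
  then show ?thesis by (auto simp: monomial_span_def poly_ring_def)
qed

lemma single_in_monomial_span:
  "Poly_Mapping.keys m \<subseteq> {1..n} \<Longrightarrow> P m \<Longrightarrow> Poly_Mapping.single m c \<in> monomial_span n P"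
  by (auto simp: monomial_span_def poly_ring_def)

lemma restrict_in_monomial_span:
  "p \<in> monomial_span n P \<Longrightarrow> restrict_monomials Q p \<in> monomial_span n (\<lambda>m. P m \<and> Q m)"
  by (auto simp: monomial_span_def poly_ring_def keys_restrict_monomials)

lemma poly_ring_0 [simp]: "0 \<in> poly_ring n"
  and poly_ring_1 [simp]: "1 \<in> poly_ring n"
  and poly_ring_single_0 [simp]: "Poly_Mapping.single 0 c \<in> poly_ring n"
  by (auto simp: poly_ring_def)

lemma poly_ring_add: "p \<in> poly_ring n \<Longrightarrow> q \<in> poly_ring n \<Longrightarrow> p + q \<in> poly_ring n"
  and poly_ring_diff: "p \<in> poly_ring n \<Longrightarrow> q \<in> poly_ring n \<Longrightarrow> p - q \<in> poly_ring n"
  and poly_ring_uminus: "p \<in> poly_ring n \<Longrightarrow> - p \<in> poly_ring n"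
  and poly_ring_mult: "p \<in> poly_ring n \<Longrightarrow> q \<in> poly_ring n \<Longrightarrow> p * q \<in> poly_ring n"
  and poly_ring_sum: "(\<And>i. i \<in> A \<Longrightarrow> f i \<in> poly_ring n) \<Longrightarrow> (\<Sum>i\<in>A. f i) \<in> poly_ring n"
  unfolding poly_ring_eq_monomial_span
  by (auto intro: monomial_span_add monomial_span_diff monomial_span_uminus monomial_span_mult
      monomial_span_sum)

lemma poly_ring_restrict: "p \<in> poly_ring n \<Longrightarrow> restrict_monomials P p \<in> poly_ring n"
  by (auto simp: poly_ring_def keys_restrict_monomials)

lemma poly_mapping_sum_singles:
  "(p :: 'k::field mpol) =
     (\<Sum>m\<in>Poly_Mapping.keys p. Poly_Mapping.single m (Poly_Mapping.lookup p m))"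
  using restrict_monomials_id[of p "\<lambda>_. True"] by (simp add: restrict_monomials_def)

lemma divide_by_monomial:
  assumes "p \<in> monomial_span n P" "\<And>m. m \<in> Poly_Mapping.keys p \<Longrightarrow> \<exists>m'. m = t + m'"
  shows "\<exists>q\<in>monomial_span n (\<lambda>m'. P (t + m')). p = Poly_Mapping.single t 1 * q"
proof -
  define q where
    "q = (\<Sum>m\<in>Poly_Mapping.keys p. Poly_Mapping.single (m - t) (Poly_Mapping.lookup p m))"
  have t: "t + (m - t) = m" if "m \<in> Poly_Mapping.keys p" for m
    using assms(2)[OF that] by auto
  have "Poly_Mapping.single t 1 * q =
      (\<Sum>m\<in>Poly_Mapping.keys p. Poly_Mapping.single m (Poly_Mapping.lookup p m))"
    unfolding q_def sum_distrib_left by (intro sum.cong refl) (simp add: mult_single t)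
  then have "Poly_Mapping.single t 1 * q = p"
    using poly_mapping_sum_singles[of p] by simp
  moreover have "q \<in> monomial_span n (\<lambda>m'. P (t + m'))"
    unfolding q_def
  proof (intro monomial_span_sum single_in_monomial_span)
    fix m assume m: "m \<in> Poly_Mapping.keys p"
    show "P (t + (m - t))" using t[OF m] m assms(1) by (auto simp: monomial_span_def)
    show "Poly_Mapping.keys (m - t) \<subseteq> {1..n}"
      using t[OF m] keys_add_nat[of t "m - t"] m assms(1)
      by (auto simp: monomial_span_def poly_ring_def)
  qed
  ultimately show ?thesis by metis
qed

section \<open>Variables and the ideals they generate\<close>

definition var :: "nat \<Rightarrow> 'k::field mpol" where
  "var v = Poly_Mapping.single (Poly_Mapping.single v 1) 1"

text \<open>The ideal generated by the variables \<open>x\<^sub>v\<close> with \<open>v \<in> V\<close>: a polynomial belongs to it iff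
  each of its monomials involves one of these variables.\<close>

definition variable_ideal :: "nat \<Rightarrow> nat set \<Rightarrow> 'k::field mpol set" where
  "variable_ideal n V = monomial_span n (\<lambda>m. Poly_Mapping.keys m \<inter> V \<noteq> {})"

lemma var_in_poly_ring: "v \<in> {1..n} \<Longrightarrow> var v \<in> poly_ring n"
  by (simp add: poly_ring_def var_def)

lemma var_nonzero: "var v \<noteq> (0 :: 'k::field mpol)"
  by (metis lookup_single_eq lookup_zero one_neq_zero var_def)

lemma var_in_variable_ideal: "v \<in> {1..n} \<Longrightarrow> v \<in> V \<Longrightarrow> var v \<in> variable_ideal n V"
  unfolding variable_ideal_def var_def by (rule single_in_monomial_span) auto

lemma variable_ideal_poly_ring: "p \<in> variable_ideal n V \<Longrightarrow> p \<in> poly_ring n"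
  by (simp add: variable_ideal_def monomial_span_def)

lemma variable_ideal_0 [simp]: "0 \<in> variable_ideal n V"
  by (simp add: variable_ideal_def)

lemma variable_ideal_add:
    "p \<in> variable_ideal n V \<Longrightarrow> q \<in> variable_ideal n V \<Longrightarrow> p + q \<in> variable_ideal n V"
  and variable_ideal_diff:
    "p \<in> variable_ideal n V \<Longrightarrow> q \<in> variable_ideal n V \<Longrightarrow> p - q \<in> variable_ideal n V"
  and variable_ideal_uminus: "p \<in> variable_ideal n V \<Longrightarrow> - p \<in> variable_ideal n V"
  and variable_ideal_sum:
    "(\<And>i. i \<in> A \<Longrightarrow> f i \<in> variable_ideal n V) \<Longrightarrow> (\<Sum>i\<in>A. f i) \<in> variable_ideal n V"
  unfolding variable_ideal_def
  by (auto intro: monomial_span_add monomial_span_diff monomial_span_uminus monomial_span_sum)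

lemma variable_ideal_mult:
    "p \<in> poly_ring n \<Longrightarrow> q \<in> variable_ideal n V \<Longrightarrow> p * q \<in> variable_ideal n V"
  and variable_ideal_mult':
    "q \<in> variable_ideal n V \<Longrightarrow> p \<in> poly_ring n \<Longrightarrow> q * p \<in> variable_ideal n V"
  unfolding variable_ideal_def poly_ring_eq_monomial_span
  by (auto intro!: monomial_span_mult simp: keys_add_nat)

lemma variable_ideal_restrict:
  "p \<in> variable_ideal n V \<Longrightarrow> restrict_monomials P p \<in> variable_ideal n V"
  unfolding variable_ideal_def by (auto dest: restrict_in_monomial_span intro: monomial_span_mono)

lemma variable_ideal_mono: "p \<in> variable_ideal n V \<Longrightarrow> V \<subseteq> V' \<Longrightarrow> p \<in> variable_ideal n V'"
  unfolding variable_ideal_def by (erule monomial_span_mono) auto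

lemma lookup_mult_monomial:
  "Poly_Mapping.lookup (Poly_Mapping.single t 1 * p) (t + m) = (Poly_Mapping.lookup p m :: 'k::field)"
  for t m :: "nat \<Rightarrow>\<^sub>0 nat"
proof -
  have "Poly_Mapping.lookup (Poly_Mapping.single t 1 * p) (t + m) =
     (\<Sum>m'\<in>Poly_Mapping.keys p. if m' = m then Poly_Mapping.lookup p m' else 0)"
    by (subst poly_mapping_sum_singles[of p], unfold sum_distrib_left lookup_sum, intro sum.cong refl)
       (simp add: mult_single lookup_single when_def)
  also have "\<dots> = Poly_Mapping.lookup p m"
    by (auto simp: in_keys_iff)
  finally show ?thesis .
qed

lemma keys_mult_monomial:
  "Poly_Mapping.keys (Poly_Mapping.single t 1 * p) = (+) t ` Poly_Mapping.keys (p :: 'k::field mpol)"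
proof
  show "Poly_Mapping.keys (Poly_Mapping.single t 1 * p) \<subseteq> (+) t ` Poly_Mapping.keys p"
    using keys_mult[of "Poly_Mapping.single t 1" p] by auto
  show "(+) t ` Poly_Mapping.keys p \<subseteq> Poly_Mapping.keys (Poly_Mapping.single t 1 * p)"
    by (auto simp: in_keys_iff lookup_mult_monomial)
qed

text \<open>Ideals generated by variables are prime. This is the case in which one factor is a variable.\<close>

lemma variable_ideal_cancel_var:
  assumes "var v * p \<in> variable_ideal n V" "p \<in> poly_ring n" "v \<notin> V"
  shows "p \<in> variable_ideal n V"
  using assms by (auto simp: variable_ideal_def monomial_span_def var_def keys_mult_monomial keys_add_nat)

lemma split_off_var:
  assumes "p \<in> monomial_span n P"
  obtains q p' where "q \<in> poly_ring n" "p' \<in> monomial_span n P" "p = var v * q + p'"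
    "\<And>m. m \<in> Poly_Mapping.keys p' \<Longrightarrow> v \<notin> Poly_Mapping.keys m"
proof -
  let ?A = "restrict_monomials (\<lambda>m. v \<in> Poly_Mapping.keys m) p"
  let ?B = "restrict_monomials (\<lambda>m. v \<notin> Poly_Mapping.keys m) p"
  have "\<exists>m'. m = Poly_Mapping.single v 1 + m'" if "v \<in> Poly_Mapping.keys m" for m :: "nat \<Rightarrow>\<^sub>0 nat"
    using that by (intro exI[of _ "m - Poly_Mapping.single v 1"] poly_mapping_eqI)
      (auto simp: lookup_add lookup_minus lookup_single when_def in_keys_iff)
  then obtain q where "q \<in> monomial_span n (\<lambda>m'. True)" "?A = Poly_Mapping.single (Poly_Mapping.single v 1) 1 * q"
    using divide_by_monomial[of ?A n "\<lambda>_. True" "Poly_Mapping.single v 1"]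
      assms[THEN restrict_in_monomial_span, of "\<lambda>m. v \<in> Poly_Mapping.keys m"]
    by (fastforce simp: keys_restrict_monomials monomial_span_def)
  moreover have "?B \<in> monomial_span n P"
    using assms[THEN restrict_in_monomial_span] by (auto intro: monomial_span_mono)
  moreover have "p = ?A + ?B" by (rule restrict_monomials_split)
  moreover have "v \<notin> Poly_Mapping.keys m" if "m \<in> Poly_Mapping.keys ?B" for m
    using that by (simp add: keys_restrict_monomials)
  ultimately show ?thesis
    using that[of q ?B] unfolding var_def poly_ring_eq_monomial_span by metis
qed

lemma variable_ideal_insertE:
  assumes "p \<in> variable_ideal n (insert v V)"
  obtains q p' where "q \<in> poly_ring n" "p' \<in> variable_ideal n V" "p = var v * q + p'"
proof -
  obtain q p' where *: "q \<in> poly_ring n" "p = var v * q + p'"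
    "p' \<in> monomial_span n (\<lambda>m. Poly_Mapping.keys m \<inter> insert v V \<noteq> {})"
    "\<And>m. m \<in> Poly_Mapping.keys p' \<Longrightarrow> v \<notin> Poly_Mapping.keys m"
    using split_off_var[of p n "\<lambda>m. Poly_Mapping.keys m \<inter> insert v V \<noteq> {}" v] assms
    unfolding variable_ideal_def by blast
  then have "p' \<in> variable_ideal n V"
    by (auto simp: variable_ideal_def monomial_span_def)
  with * that show ?thesis by blast
qed

lemma variable_ideal_empty [simp]: "variable_ideal n {} = {0}"
  by (auto simp: variable_ideal_def monomial_span_def)

lemma variable_ideal_two_vars:
  assumes "p \<in> variable_ideal n {v, w}"
  shows "\<exists>q r. q \<in> poly_ring n \<and> r \<in> poly_ring n \<and> p = var v * q + var w * r"
proof -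
  obtain q p' where 1: "q \<in> poly_ring n" "p' \<in> variable_ideal n {w}" "p = var v * q + p'"
    using variable_ideal_insertE[OF assms] by blast
  moreover obtain r p'' where "r \<in> poly_ring n" "p'' \<in> variable_ideal n {}" "p' = var w * r + p''"
    using variable_ideal_insertE[OF 1(2)] by blast
  ultimately show ?thesis by auto
qed

text \<open>Two distinct variables form a regular sequence, so their only relations are the Koszul ones.\<close>

lemma vars_coprime:
  assumes "v \<noteq> w" "p \<in> poly_ring n" "q \<in> poly_ring n" "var v * p + var w * q = 0"
  obtains t where "t \<in> poly_ring n" "p = var w * t" "q = - (var v * t)"
proof -
  obtain t p' where t: "t \<in> poly_ring n" "p = var w * t + p'"
    "\<And>m. m \<in> Poly_Mapping.keys p' \<Longrightarrow> w \<notin> Poly_Mapping.keys m"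
    using split_off_var[of p n "\<lambda>_. True" w] assms(2) unfolding poly_ring_eq_monomial_span by blast
  have "var v * p' - var w * (- (var v * t) - q) = 0"
    using assms(4) unfolding t(2) by (simp add: algebra_simps)
  then have "var v * p' = var w * (- (var v * t) - q)" by simp
  then have "Poly_Mapping.keys (var v * p') = Poly_Mapping.keys (var w * (- (var v * t) - q))"
    by simp
  moreover have "w \<notin> Poly_Mapping.keys m" if "m \<in> Poly_Mapping.keys (var v * p')" for m
    using that t(3) assms(1) by (auto simp: var_def keys_mult_monomial keys_add_nat)
  moreover have "w \<in> Poly_Mapping.keys m" if "m \<in> Poly_Mapping.keys (var w * r)" for m and r :: "'a mpol"
    using that by (auto simp: var_def keys_mult_monomial keys_add_nat)
  ultimately have "Poly_Mapping.keys (var v * p') = {}" by blast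
  then have "p' = 0" by (simp add: keys_eq_empty var_nonzero)
  with t have p: "p = var w * t" by simp
  have "var w * (q + var v * t) = 0"
    using assms(4) unfolding p by (simp add: algebra_simps)
  then have "q = - (var v * t)"
    by (simp add: eq_neg_iff_add_eq_0 var_nonzero)
  with t p that show ?thesis by blast
qed

section \<open>Degrees\<close>

lemma mono_deg_eq_sum:
  "finite A \<Longrightarrow> Poly_Mapping.keys m \<subseteq> A \<Longrightarrow> mono_deg m = (\<Sum>i\<in>A. Poly_Mapping.lookup m i)"
  unfolding mono_deg_def by (rule sum.mono_neutral_left) (auto simp: in_keys_iff)

lemma mono_deg_add: "mono_deg (a + b) = mono_deg a + mono_deg b"
proof -
  let ?A = "Poly_Mapping.keys a \<union> Poly_Mapping.keys b"
  have "mono_deg (a + b) = (\<Sum>i\<in>?A. Poly_Mapping.lookup (a + b) i)"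
    by (rule mono_deg_eq_sum) (auto simp: keys_add_nat)
  also have "\<dots> = mono_deg a + mono_deg b"
    by (simp add: lookup_add sum.distrib mono_deg_eq_sum[of ?A])
  finally show ?thesis .
qed

lemma mono_deg_0 [simp]: "mono_deg 0 = 0"
  and mono_deg_single [simp]: "mono_deg (Poly_Mapping.single v e) = e"
  by (auto simp: mono_deg_def)

lemma mono_deg_eq_0_iff: "mono_deg m = 0 \<longleftrightarrow> m = 0"
  unfolding mono_deg_def by (auto simp: in_keys_iff simp flip: keys_eq_empty)

definition homogeneous_polys :: "nat \<Rightarrow> nat \<Rightarrow> 'k::field mpol set" where
  "homogeneous_polys n d = monomial_span n (\<lambda>m. mono_deg m = d)"

text \<open>The set \<open>Z\<close> is a singleton for homogeneous components and an initial segment for truncations.\<close>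

definition degree_part :: "nat set \<Rightarrow> 'k::field mpol \<Rightarrow> 'k mpol" where
  "degree_part Z = restrict_monomials (\<lambda>m. mono_deg m \<in> Z)"

lemma degree_part_mult:
  assumes "h \<in> homogeneous_polys n d" "\<And>x. x + d \<in> Z \<longleftrightarrow> x \<in> Z'"
  shows "degree_part Z (c * h) = degree_part Z' c * h"
proof -
  let ?a = "degree_part Z' c" and ?b = "restrict_monomials (\<lambda>m. \<not> mono_deg m \<in> Z') c"
  have c: "c = ?a + ?b" unfolding degree_part_def by (rule restrict_monomials_split)
  have "mono_deg m \<in> Z" if "m \<in> Poly_Mapping.keys (?a * h)" for m
    using that keys_mult[of ?a h] assms
    by (auto simp: degree_part_def keys_restrict_monomials homogeneous_polys_def monomial_span_def mono_deg_add)
  then have "degree_part Z (?a * h) = ?a * h"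
    unfolding degree_part_def by (rule restrict_monomials_id)
  moreover have "mono_deg m \<notin> Z" if "m \<in> Poly_Mapping.keys (?b * h)" for m
    using that keys_mult[of ?b h] assms
    by (auto simp: keys_restrict_monomials homogeneous_polys_def monomial_span_def mono_deg_add)
  then have "degree_part Z (?b * h) = 0"
    unfolding degree_part_def by (rule restrict_monomials_eq_0)
  ultimately show ?thesis
    using arg_cong[OF c, of "\<lambda>c. degree_part Z (c * h)"]
    by (simp add: distrib_right degree_part_def restrict_monomials_add)
qed

lemma degree_part_in_homogeneous: "p \<in> poly_ring n \<Longrightarrow> degree_part {d} p \<in> homogeneous_polys n d"
  by (auto simp: degree_part_def homogeneous_polys_def monomial_span_def poly_ring_def keys_restrict_monomials)

lemma degree_part_homogeneous: "p \<in> homogeneous_polys n d \<Longrightarrow> d \<in> Z \<Longrightarrow> degree_part Z p = p"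
  unfolding degree_part_def
  by (rule restrict_monomials_id) (auto simp: homogeneous_polys_def monomial_span_def)

lemma degree_part_empty [simp]: "degree_part {} p = 0"
  unfolding degree_part_def by (rule restrict_monomials_eq_0) auto

lemma degree_part_0 [simp]: "degree_part Z 0 = 0"
  by (simp add: degree_part_def)

lemma degree_part_add: "degree_part Z (p + q) = degree_part Z p + degree_part Z q"
  and degree_part_diff: "degree_part Z (p - q) = degree_part Z p - degree_part Z q"
  and degree_part_sum: "degree_part Z (\<Sum>i\<in>A. f i) = (\<Sum>i\<in>A. degree_part Z (f i))"
  and poly_ring_degree_part: "p \<in> poly_ring n \<Longrightarrow> degree_part Z p \<in> poly_ring n"
  and variable_ideal_degree_part: "p \<in> variable_ideal n V \<Longrightarrow> degree_part Z p \<in> variable_ideal n V"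
  by (simp_all add: degree_part_def restrict_monomials_add restrict_monomials_diff
      restrict_monomials_sum poly_ring_restrict variable_ideal_restrict)

lemma homogeneous_polys_poly_ring: "p \<in> homogeneous_polys n d \<Longrightarrow> p \<in> poly_ring n"
  by (simp add: homogeneous_polys_def monomial_span_def)

lemma homogeneous_polys_sum:
  "(\<And>i. i \<in> A \<Longrightarrow> f i \<in> homogeneous_polys n d) \<Longrightarrow> (\<Sum>i\<in>A. f i) \<in> homogeneous_polys n d"
  unfolding homogeneous_polys_def by (rule monomial_span_sum)

lemma homogeneous_polys_mult:
  "p \<in> homogeneous_polys n d \<Longrightarrow> q \<in> homogeneous_polys n d' \<Longrightarrow> p * q \<in> homogeneous_polys n (d + d')"
  unfolding homogeneous_polys_def by (erule monomial_span_mult) (auto simp: mono_deg_add)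

lemma var_homogeneous: "v \<in> {1..n} \<Longrightarrow> var v \<in> homogeneous_polys n 1"
  unfolding homogeneous_polys_def var_def by (rule single_in_monomial_span) auto

lemma homogeneous_0_scalar:
  assumes "p \<in> homogeneous_polys n 0"
  shows "p = Poly_Mapping.single 0 (Poly_Mapping.lookup p 0)"
  using assms by (intro poly_mapping_eqI)
    (auto simp: homogeneous_polys_def monomial_span_def mono_deg_eq_0_iff in_keys_iff lookup_single when_def)

lemma degree_part_large:
  assumes "finite A"
  shows "\<exists>N. \<forall>i\<in>A. degree_part {..<N} (f i) = f i"
proof -
  have "finite (\<Union>i\<in>A. mono_deg ` Poly_Mapping.keys (f i))" using assms by simp
  then obtain N where "\<forall>x\<in>(\<Union>i\<in>A. mono_deg ` Poly_Mapping.keys (f i)). x < N"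
    using finite_nat_set_iff_bounded by blast
  then have "\<forall>i\<in>A. degree_part {..<N} (f i) = f i"
    unfolding degree_part_def by (auto intro!: restrict_monomials_id)
  then show ?thesis ..
qed

section \<open>Submodules of free modules\<close>

definition poly_submodule :: "nat \<Rightarrow> (nat \<Rightarrow> 'k::field mpol) set \<Rightarrow> bool" where
  "poly_submodule n M \<longleftrightarrow>
     (\<lambda>_. 0) \<in> M \<and> (\<forall>v\<in>M. \<forall>l. v l \<in> poly_ring n) \<and>
     (\<forall>u\<in>M. \<forall>v\<in>M. \<forall>r\<in>poly_ring n. (\<lambda>l. u l + r * v l) \<in> M)"

lemma poly_submoduleD:
  assumes "poly_submodule n M"
  shows poly_submodule_0: "(\<lambda>_. 0) \<in> M"
    and poly_submodule_poly_ring: "v \<in> M \<Longrightarrow> v l \<in> poly_ring n"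
    and poly_submodule_add_mult:
      "u \<in> M \<Longrightarrow> v \<in> M \<Longrightarrow> r \<in> poly_ring n \<Longrightarrow> (\<lambda>l. u l + r * v l) \<in> M"
  using assms by (auto simp: poly_submodule_def)

lemma poly_submodule_mult:
  assumes "poly_submodule n M" "v \<in> M" "r \<in> poly_ring n"
  shows "(\<lambda>l. r * v l) \<in> M"
  using poly_submodule_add_mult[OF assms(1) poly_submodule_0[OF assms(1)] assms(2,3)] by simp

lemma poly_submodule_diff:
  assumes "poly_submodule n M" "u \<in> M" "v \<in> M"
  shows "(\<lambda>l. u l - v l) \<in> M"
  using poly_submodule_add_mult[OF assms, of "- 1"] by (simp add: poly_ring_uminus)

lemma poly_submodule_sum:
  assumes "poly_submodule n M" "\<And>i. i \<in> A \<Longrightarrow> c i \<in> poly_ring n" "\<And>i. i \<in> A \<Longrightarrow> g i \<in> M"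
  shows "(\<lambda>l. \<Sum>i\<in>A. c i * g i l) \<in> M"
  using assms(2,3)
proof (induction A rule: infinite_finite_induct)
  case (insert x F)
  then show ?case
    using poly_submodule_add_mult[OF assms(1), of "\<lambda>l. \<Sum>i\<in>F. c i * g i l" "g x" "c x"]
    by (simp add: add.commute)
qed (use poly_submodule_0[OF assms(1)] in auto)

lemma poly_span_subset:
  assumes "poly_submodule n M" "\<And>j. j \<in> A \<Longrightarrow> g j \<in> M"
  shows "poly_span n A g \<subseteq> M"
proof
  fix v assume "v \<in> poly_span n A g"
  then obtain c where "\<forall>j\<in>A. c j \<in> poly_ring n" "v = (\<lambda>l. \<Sum>j\<in>A. c j * g j l)"
    unfolding poly_span_def by blast
  then show "v \<in> M" using poly_submodule_sum[OF assms(1), of A c g] assms(2) by simp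
qed

lemma poly_spanI:
  "(\<And>j. j \<in> A \<Longrightarrow> c j \<in> poly_ring n) \<Longrightarrow> (\<And>l. v l = (\<Sum>j\<in>A. c j * g j l)) \<Longrightarrow> v \<in> poly_span n A g"
  unfolding poly_span_def by blast

lemma poly_spanE:
  assumes "v \<in> poly_span n A g"
  obtains c where "\<And>j. j \<in> A \<Longrightarrow> c j \<in> poly_ring n" "\<And>l. v l = (\<Sum>j\<in>A. c j * g j l)"
  using assms unfolding poly_span_def by auto

lemma poly_submodule_span:
  assumes "\<And>j l. j \<in> A \<Longrightarrow> g j l \<in> poly_ring n"
  shows "poly_submodule n (poly_span n A g)"
  unfolding poly_submodule_def
proof (intro conjI ballI allI)
  show "(\<lambda>_. 0) \<in> poly_span n A g" by (rule poly_spanI[of _ "\<lambda>_. 0"]) auto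
next
  fix v l assume "v \<in> poly_span n A g"
  then show "v l \<in> poly_ring n"
    by (elim poly_spanE) (auto intro!: poly_ring_sum poly_ring_mult assms)
next
  fix u v :: "nat \<Rightarrow> 'a mpol" and r :: "'a mpol"
  assume "u \<in> poly_span n A g" "v \<in> poly_span n A g" and r: "r \<in> poly_ring n"
  then obtain c d where "\<And>j. j \<in> A \<Longrightarrow> c j \<in> poly_ring n" "\<And>l. u l = (\<Sum>j\<in>A. c j * g j l)"
    "\<And>j. j \<in> A \<Longrightarrow> d j \<in> poly_ring n" "\<And>l. v l = (\<Sum>j\<in>A. d j * g j l)"
    by (elim poly_spanE) blast
  with r show "(\<lambda>l. u l + r * v l) \<in> poly_span n A g"
    by (intro poly_spanI[of _ "\<lambda>j. c j + r * d j"])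
      (auto intro!: poly_ring_add poly_ring_mult simp: sum.distrib sum_distrib_left algebra_simps)
qed

lemma generator_in_poly_span:
  assumes "finite A" "j \<in> A" shows "g j \<in> poly_span n A g"
proof (rule poly_spanI[of _ "\<lambda>i. if i = j then 1 else 0"])
  have "(\<Sum>i\<in>A. (if i = j then 1 else 0) * g i l) = (\<Sum>i\<in>A. if i = j then g i l else 0)" for l
    by (rule sum.cong) auto
  then show "g j l = (\<Sum>i\<in>A. (if i = j then 1 else 0) * g i l)" for l
    using assms by simp
qed auto

lemma poly_span_cong:
  assumes "\<And>j. j \<in> A \<Longrightarrow> g j = g' j"
  shows "poly_span n A g = poly_span n A g'"
proof -
  have "(\<Sum>j\<in>A. c j * g j l) = (\<Sum>j\<in>A. c j * g' j l)" for c l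
    using assms by (intro sum.cong) auto
  then show ?thesis unfolding poly_span_def by simp
qed

lemma poly_submodule_syzygy_module: "poly_submodule n (syzygy_module n b g)"
  unfolding poly_submodule_def
proof (intro conjI ballI allI)
  fix u v :: "nat \<Rightarrow> 'a mpol" and r :: "'a mpol"
  assume "u \<in> syzygy_module n b g" "v \<in> syzygy_module n b g" "r \<in> poly_ring n"
  moreover have "(\<Sum>j<b. (u j + r * v j) * g j l) = (\<Sum>j<b. u j * g j l) + r * (\<Sum>j<b. v j * g j l)" for l
    by (simp add: distrib_right sum.distrib mult.assoc sum_distrib_left)
  ultimately show "(\<lambda>l. u l + r * v l) \<in> syzygy_module n b g"
    by (auto simp: syzygy_module_def intro!: poly_ring_add poly_ring_mult)
qed (auto simp: syzygy_module_def)

section \<open>Linear quotients modulo two parameters\<close>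

text \<open>The variables \<open>x\<^sub>p\<close> and \<open>x\<^sub>q\<close> play the role of a system of parameters: modules are studied
  through their reduction modulo \<open>(x\<^sub>p, x\<^sub>q)\<close>.\<close>

locale two_parameters =
  fixes n p q :: nat
  assumes p_var: "p \<in> {1..n}" and q_var: "q \<in> {1..n}" and p_neq_q: "p \<noteq> q"
begin

abbreviation parameter_ideal :: "'k::field mpol set" where
  "parameter_ideal \<equiv> variable_ideal n {p, q}"

definition param_congruent :: "(nat \<Rightarrow> 'k::field mpol) \<Rightarrow> (nat \<Rightarrow> 'k mpol) \<Rightarrow> bool" where
  "param_congruent u v \<longleftrightarrow> (\<forall>l. u l - v l \<in> parameter_ideal)"

text \<open>Modulo the parameters, the colon ideal of the submodule generated by the predecessors of
  \<open>h j\<close>, by \<open>h j\<close>, is generated by the variables in \<open>V\<close>. As the parameters belong to \<open>V\<close>, the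
  condition can be stated in the polynomial ring itself.\<close>

definition colon_generated_by ::
    "nat set \<Rightarrow> (nat \<Rightarrow> nat \<Rightarrow> 'k::field mpol) \<Rightarrow> nat \<Rightarrow> bool" where
  "colon_generated_by V h j \<longleftrightarrow> {p, q} \<subseteq> V \<and> V \<subseteq> {1..n} \<and>
     (\<forall>r\<in>poly_ring n.
        (\<exists>s\<in>poly_span n {..<j} h. param_congruent (\<lambda>l. r * h j l) s) \<longleftrightarrow> r \<in> variable_ideal n V)"

definition linear_quotients :: "nat \<Rightarrow> nat \<Rightarrow> (nat \<Rightarrow> nat \<Rightarrow> 'k::field mpol) \<Rightarrow> bool" where
  "linear_quotients d m h \<longleftrightarrow>
     (\<forall>j<m. (\<forall>l. h j l \<in> homogeneous_polys n d) \<and> (\<exists>V. colon_generated_by V h j))"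

text \<open>The generators reach \<open>Q\<close> only up to the parameters. This is what makes the
  property extend along chains of submodules; \<open>nakayama_homogeneous\<close> removes the congruence at
  the end of the chain.\<close>

definition generated_with_linear_quotients :: "nat \<Rightarrow> (nat \<Rightarrow> 'k::field mpol) set \<Rightarrow> bool" where
  "generated_with_linear_quotients d Q \<longleftrightarrow>
     (\<exists>m h. linear_quotients d m h \<and> (\<forall>j<m. h j \<in> Q) \<and>
        (\<forall>s\<in>Q. \<exists>s'\<in>poly_span n {..<m} h. param_congruent s s'))"

text \<open>Inside the free module \<open>F\<close> of all vectors of polynomials, the first condition says that
  \<open>x\<^sub>q\<close> is a nonzerodivisor on \<open>F / M\<close>, and the second one that
  \<open>M \<inter> (x\<^sub>p, x\<^sub>q) F = (x\<^sub>p, x\<^sub>q) M\<close>, so that nothing of \<open>M\<close> beyond \<open>(x\<^sub>p, x\<^sub>q) M\<close> is lost by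
  reduction modulo the parameters. Both hold if \<open>x\<^sub>q, x\<^sub>p\<close> is a regular sequence on \<open>F / M\<close>.\<close>

definition parameters_regular :: "(nat \<Rightarrow> 'k::field mpol) set \<Rightarrow> bool" where
  "parameters_regular M \<longleftrightarrow>
     (\<forall>u. (\<forall>l. u l \<in> poly_ring n) \<and> (\<lambda>l. var q * u l) \<in> M \<longrightarrow> u \<in> M) \<and>
     (\<forall>v\<in>M. (\<forall>l. v l \<in> parameter_ideal) \<longrightarrow>
        (\<exists>s\<in>M. \<exists>t\<in>M. \<forall>l. v l = var p * s l + var q * t l))"

text \<open>The property that is passed on from a module to its syzygies. Linear quotients are only
  required modulo the parameters: the ideal of the twisted cubic is generated by three quadrics any
  two of which are coprime, so over the whole ring the second colon ideal would not be generated by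
  variables.\<close>

definition linear_module :: "nat \<Rightarrow> (nat \<Rightarrow> 'k::field mpol) set \<Rightarrow> bool" where
  "linear_module d M \<longleftrightarrow> parameters_regular M \<and>
     (\<exists>m h. linear_quotients d m h \<and> M = poly_span n {..<m} h)"

lemma parameters_regular_cancel:
  "parameters_regular M \<Longrightarrow> (\<And>l. u l \<in> poly_ring n) \<Longrightarrow> (\<lambda>l. var q * u l) \<in> M \<Longrightarrow> u \<in> M"
  by (simp add: parameters_regular_def)

lemma parameters_regular_split:
  assumes "parameters_regular M" "v \<in> M" "\<And>l. v l \<in> parameter_ideal"
  obtains s t where "s \<in> M" "t \<in> M" "\<And>l. v l = var p * s l + var q * t l"
  using assms unfolding parameters_regular_def by meson

lemma param_congruent_refl [simp]: "param_congruent u u"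
  by (simp add: param_congruent_def)

text \<open>One more generator \<open>h\<close>: the hypotheses \<open>colon_ge\<close> and \<open>colon_le\<close> compute the colon ideal
  \<open>(Q : h)\<close> modulo the parameters, and \<open>span\<close> says that \<open>h\<close> suffices to get from \<open>Q\<close> to \<open>Q'\<close>. Since \<open>Q\<close>
  is known as a submodule, it never has to be described by its generators.\<close>

lemma generated_with_linear_quotients_extend:
  assumes Q: "generated_with_linear_quotients d Q" "poly_submodule n Q" "Q \<subseteq> Q'"
    and h: "h \<in> Q'" "\<And>l. h l \<in> homogeneous_polys n d"
    and V: "{p, q} \<subseteq> V" "V \<subseteq> {1..n}"
    and colon_ge: "\<And>r. r \<in> variable_ideal n V \<Longrightarrow> (\<lambda>l. r * h l) \<in> Q"
    and colon_le: "\<And>r s. r \<in> poly_ring n \<Longrightarrow> s \<in> Q \<Longrightarrow> param_congruent (\<lambda>l. r * h l) s \<Longrightarrow>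
                     r \<in> variable_ideal n V"
    and span: "\<And>s. s \<in> Q' \<Longrightarrow> \<exists>r\<in>poly_ring n. (\<lambda>l. s l - r * h l) \<in> Q"
  shows "generated_with_linear_quotients d Q'"
proof -
  obtain m g where g: "linear_quotients d m g" "\<And>j. j < m \<Longrightarrow> g j \<in> Q"
    "\<And>s. s \<in> Q \<Longrightarrow> \<exists>s'\<in>poly_span n {..<m} g. param_congruent s s'"
    using Q(1) unfolding generated_with_linear_quotients_def by blast
  define g' where "g' = g(m := h)"
  have same_span: "poly_span n {..<j} g' = poly_span n {..<j} g" if "j \<le> m" for j
    using that by (intro poly_span_cong) (auto simp: g'_def)
  have last: "g' m = h" by (simp add: g'_def)
  have "colon_generated_by V g' m"
    unfolding colon_generated_by_def
  proof (intro conjI V ballI iffI)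
    fix r :: "'a mpol" assume r: "r \<in> poly_ring n"
    assume "\<exists>s\<in>poly_span n {..<m} g'. param_congruent (\<lambda>l. r * g' m l) s"
    then show "r \<in> variable_ideal n V"
      using colon_le[OF r] poly_span_subset[OF Q(2), of "{..<m}" g] g(2)
      by (auto simp: same_span last)
  next
    fix r :: "'a mpol" assume "r \<in> variable_ideal n V"
    then show "\<exists>s\<in>poly_span n {..<m} g'. param_congruent (\<lambda>l. r * g' m l) s"
      using g(3)[OF colon_ge] by (simp add: same_span last)
  qed
  moreover have g'_j: "g' j = g j" if "j < m" for j
    using that by (simp add: g'_def)
  moreover have "colon_generated_by U g' j" if "colon_generated_by U g j" "j < m" for U j
    using that by (simp add: colon_generated_by_def same_span g'_j)
  ultimately have "linear_quotients d (Suc m) g'"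
    using g(1) h(2) last unfolding linear_quotients_def less_Suc_eq by metis
  moreover have "g' j \<in> Q'" if "j < Suc m" for j
    using that g(2) Q(3) h(1) by (auto simp: g'_def less_Suc_eq)
  moreover have "\<exists>s'\<in>poly_span n {..<Suc m} g'. param_congruent s s'" if s: "s \<in> Q'" for s
  proof -
    obtain r where r: "r \<in> poly_ring n" "(\<lambda>l. s l - r * h l) \<in> Q" using span[OF s] by blast
    then obtain t where t: "t \<in> poly_span n {..<m} g" "param_congruent (\<lambda>l. s l - r * h l) t"
      using g(3) by blast
    then obtain c where c: "\<And>j. j < m \<Longrightarrow> c j \<in> poly_ring n" "\<And>l. t l = (\<Sum>j<m. c j * g j l)"
      by (elim poly_spanE) auto
    have "(\<lambda>l. t l + r * h l) \<in> poly_span n {..<Suc m} g'"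
      using c r(1) by (intro poly_spanI[of _ "c(m := r)"]) (auto simp: g'_def)
    moreover have "param_congruent s (\<lambda>l. t l + r * h l)"
      using t(2) by (simp add: param_congruent_def algebra_simps)
    ultimately show ?thesis by blast
  qed
  ultimately show ?thesis unfolding generated_with_linear_quotients_def by blast
qed

lemma poly_span_degree_part:
  assumes "\<And>j l. j \<in> A \<Longrightarrow> h j l \<in> homogeneous_polys n d" "v \<in> poly_span n A h"
  shows "(\<lambda>l. degree_part Z (v l)) \<in> poly_span n A h"
proof -
  obtain c where c: "\<And>j. j \<in> A \<Longrightarrow> c j \<in> poly_ring n" "\<And>l. v l = (\<Sum>j\<in>A. c j * h j l)"
    using poly_spanE[OF assms(2)] by blast
  then show ?thesis
    by (intro poly_spanI[of _ "\<lambda>j. degree_part {x. x + d \<in> Z} (c j)"])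
      (auto simp: degree_part_sum poly_ring_degree_part
         intro!: sum.cong degree_part_mult assms(1))
qed

text \<open>Nakayama's lemma for graded modules. An element \<open>v\<close> of \<open>M\<close> differs from the span of the
  generators by some \<open>x\<^sub>p t + x\<^sub>q u\<close> with \<open>t, u \<in> M\<close>, and the part of \<open>v\<close> in degrees below \<open>N + 1\<close> only
  sees the parts of \<open>t\<close> and \<open>u\<close> in degrees below \<open>N\<close>. This gives an induction on the truncation degree.\<close>

lemma nakayama_homogeneous:
  assumes M: "poly_submodule n M" "parameters_regular M"
    and fin: "\<And>v. v \<in> M \<Longrightarrow> \<exists>N. \<forall>l. degree_part {..<N} (v l) = v l"
    and g: "generated_with_linear_quotients d M"
  shows "linear_module d M"
proof -
  obtain m h where h: "linear_quotients d m h" "\<And>j. j < m \<Longrightarrow> h j \<in> M"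
    "\<And>s. s \<in> M \<Longrightarrow> \<exists>s'\<in>poly_span n {..<m} h. param_congruent s s'"
    using g unfolding generated_with_linear_quotients_def by blast
  have hom: "h j l \<in> homogeneous_polys n d" if "j < m" for j l
    using h(1) that by (simp add: linear_quotients_def)
  have sub: "poly_submodule n (poly_span n {..<m} h)"
    by (rule poly_submodule_span) (auto intro: homogeneous_polys_poly_ring[OF hom])
  have span_M: "poly_span n {..<m} h \<subseteq> M"
    using h(2) by (intro poly_span_subset[OF M(1)]) auto
  have *: "(\<lambda>l. degree_part {..<N} (v l)) \<in> poly_span n {..<m} h" if "v \<in> M" for v N
    using that
  proof (induction N arbitrary: v)
    case 0
    then show ?case using poly_submodule_0[OF sub] by simp
  next
    case (Suc N)
    obtain s where s: "s \<in> poly_span n {..<m} h" "param_congruent v s" using h(3)[OF Suc.prems] by blast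
    then have "(\<lambda>l. v l - s l) \<in> M" "\<And>l. v l - s l \<in> parameter_ideal"
      using poly_submodule_diff[OF M(1) Suc.prems] span_M by (auto simp: param_congruent_def)
    then obtain t u where tu: "t \<in> M" "u \<in> M" "\<And>l. v l - s l = var p * t l + var q * u l"
      by (rule parameters_regular_split[OF M(2)]) blast
    have v: "degree_part {..<Suc N} (v l) = (degree_part {..<Suc N} (s l) +
       var p * degree_part {..<N} (t l)) + var q * degree_part {..<N} (u l)" for l
    proof -
      have "v l = s l + (t l * var p + u l * var q)" using tu(3)[of l] by (simp add: algebra_simps)
      moreover have "degree_part {..<Suc N} (x * var z) = degree_part {..<N} x * var z"
        if "z \<in> {1..n}" for x :: "'a mpol" and z
        by (rule degree_part_mult[OF var_homogeneous[OF that]]) simp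
      note this[OF p_var, of "t l"] this[OF q_var, of "u l"]
      ultimately show ?thesis
        by (simp add: degree_part_add add.assoc mult.commute[of "var p" "degree_part {..<N} (t l)"]
            mult.commute[of "var q" "degree_part {..<N} (u l)"])
    qed
    have s': "(\<lambda>l. degree_part {..<Suc N} (s l)) \<in> poly_span n {..<m} h"
      using hom s(1) by (intro poly_span_degree_part) auto
    show ?case
      unfolding v
      by (intro poly_submodule_add_mult[OF sub] s' Suc.IH tu var_in_poly_ring p_var q_var)
  qed
  have "v \<in> poly_span n {..<m} h" if "v \<in> M" for v
    using fin[OF that] *[OF that] by (metis ext)
  with span_M have "M = poly_span n {..<m} h" by blast
  then show ?thesis
    unfolding linear_module_def using M(2) h(1) by blast
qed

end

section \<open>Syzygies inherit linear quotients\<close>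

lemma syzygy_moduleI:
  "(\<And>j. c j \<in> poly_ring n) \<Longrightarrow> (\<And>j. j \<ge> b \<Longrightarrow> c j = 0) \<Longrightarrow> (\<And>l. (\<Sum>j<b. c j * g j l) = 0) \<Longrightarrow>
     c \<in> syzygy_module n b g"
  by (simp add: syzygy_module_def)

lemma syzygy_moduleD:
  assumes "c \<in> syzygy_module n b g"
  shows "c j \<in> poly_ring n" "j \<ge> b \<Longrightarrow> c j = 0" "(\<Sum>j<b. c j * g j l) = 0"
  using assms by (simp_all add: syzygy_module_def)

lemma syzygy_module_degree_part:
  assumes "\<And>j l. j < b \<Longrightarrow> h j l \<in> homogeneous_polys n d" "c \<in> syzygy_module n b h"
  shows "(\<lambda>j. degree_part {x} (c j)) \<in> syzygy_module n b h"
proof (rule syzygy_moduleI)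
  fix l
  have "(\<Sum>j<b. degree_part {x} (c j) * h j l) = (\<Sum>j<b. degree_part {x + d} (c j * h j l))"
    by (intro sum.cong refl degree_part_mult[where n = n and d = d, symmetric] assms(1)) auto
  also have "\<dots> = 0"
    using syzygy_moduleD(3)[OF assms(2)] by (simp flip: degree_part_sum)
  finally show "(\<Sum>j<b. degree_part {x} (c j) * h j l) = 0" .
qed (use syzygy_moduleD[OF assms(2)] in \<open>auto intro: poly_ring_degree_part\<close>)

context two_parameters
begin

text \<open>The quotient of the free module by the syzygies embeds into a free module, which gives
  the first condition. For the second one, split a syzygy as \<open>x\<^sub>p a + x\<^sub>q c\<close>. The images \<open>y\<close> and \<open>z\<close>
  of \<open>a\<close> and \<open>c\<close> satisfy \<open>x\<^sub>p y + x\<^sub>q z = 0\<close>, so \<open>y = x\<^sub>q t\<close> and \<open>z = - x\<^sub>p t\<close>, and \<open>t\<close> lies in the module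
  because \<open>x\<^sub>q t\<close> does. Subtracting the Koszul relation given by a preimage \<open>w\<close> of \<open>t\<close> turns \<open>a\<close>
  and \<open>c\<close> into syzygies.\<close>

lemma parameters_regular_syzygy_module:
  assumes R: "\<And>j l. j < b \<Longrightarrow> h j l \<in> poly_ring n"
    and M: "parameters_regular (poly_span n {..<b} h)"
  shows "parameters_regular (syzygy_module n b h)"
  unfolding parameters_regular_def
proof (intro conjI allI impI ballI)
  fix u :: "nat \<Rightarrow> 'a mpol"
  assume u: "(\<forall>l. u l \<in> poly_ring n) \<and> (\<lambda>l. var q * u l) \<in> syzygy_module n b h"
  show "u \<in> syzygy_module n b h"
  proof (rule syzygy_moduleI)
    show "u j = 0" if "j \<ge> b" for j
      using syzygy_moduleD(2)[OF conjunct2[OF u] that] by (simp add: var_nonzero)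
    fix l
    have "var q * (\<Sum>j<b. u j * h j l) = 0"
      using syzygy_moduleD(3)[OF conjunct2[OF u], of l] by (simp add: sum_distrib_left mult.assoc)
    then show "(\<Sum>j<b. u j * h j l) = 0" by (simp add: var_nonzero)
  qed (use u in auto)
next
  fix v assume v: "v \<in> syzygy_module n b h" and "\<forall>l. v l \<in> parameter_ideal"
  then have "\<forall>j. \<exists>a c. a \<in> poly_ring n \<and> c \<in> poly_ring n \<and> v j = var p * a + var q * c"
    using variable_ideal_two_vars by blast
  then obtain a c where ac: "\<And>j. a j \<in> poly_ring n" "\<And>j. c j \<in> poly_ring n"
    "\<And>j. v j = var p * a j + var q * c j" by metis
  define y where "y l = (\<Sum>j<b. a j * h j l)" for l
  define z where "z l = (\<Sum>j<b. c j * h j l)" for l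
  have y_R: "y l \<in> poly_ring n" and z_R: "z l \<in> poly_ring n" for l
    unfolding y_def z_def by (auto intro!: poly_ring_sum poly_ring_mult ac R)
  have yz: "var p * y l + var q * z l = 0" for l
    using syzygy_moduleD(3)[OF v, of l]
    by (simp add: y_def z_def ac(3) distrib_right sum.distrib mult.assoc sum_distrib_left)
  have "\<exists>t. t \<in> poly_ring n \<and> y l = var q * t \<and> z l = - (var p * t)" for l
    using vars_coprime[OF p_neq_q y_R z_R yz] by blast
  then obtain t where t: "\<And>l. t l \<in> poly_ring n" "\<And>l. y l = var q * t l" "\<And>l. z l = - (var p * t l)"
    by metis
  have "y \<in> poly_span n {..<b} h" by (rule poly_spanI[of _ a]) (auto simp: y_def ac)
  moreover have "y = (\<lambda>l. var q * t l)" using t(2) by blast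
  ultimately have "t \<in> poly_span n {..<b} h"
    using parameters_regular_cancel[OF M t(1)] by simp
  then obtain w where w: "\<And>j. j < b \<Longrightarrow> w j \<in> poly_ring n" "\<And>l. t l = (\<Sum>j<b. w j * h j l)"
    by (rule poly_spanE) blast
  define s where "s j = (if j < b then a j - var q * w j else 0)" for j
  define s' where "s' j = (if j < b then c j + var p * w j else 0)" for j
  show "\<exists>s\<in>syzygy_module n b h. \<exists>t\<in>syzygy_module n b h. \<forall>l. v l = var p * s l + var q * t l"
  proof (intro bexI allI)
    show "v j = var p * s j + var q * s' j" for j
      using ac(3)[of j] syzygy_moduleD(2)[OF v, of j]
      by (cases "j < b") (simp_all add: s_def s'_def algebra_simps)
    show "s \<in> syzygy_module n b h"
    proof (rule syzygy_moduleI)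
      fix l
      have "(\<Sum>j<b. s j * h j l) = y l - var q * t l"
        by (simp add: s_def y_def w(2) left_diff_distrib sum_subtractf sum_distrib_left mult.assoc)
      then show "(\<Sum>j<b. s j * h j l) = 0" using t(2) by simp
    qed (auto simp: s_def intro!: poly_ring_diff poly_ring_mult ac w var_in_poly_ring q_var)
    show "s' \<in> syzygy_module n b h"
    proof (rule syzygy_moduleI)
      fix l
      have "(\<Sum>j<b. s' j * h j l) = z l + var p * t l"
        by (simp add: s'_def z_def w(2) distrib_right sum.distrib sum_distrib_left mult.assoc)
      then show "(\<Sum>j<b. s' j * h j l) = 0" using t(3) by simp
    qed (auto simp: s'_def intro!: poly_ring_add poly_ring_mult ac w var_in_poly_ring p_var)
  qed
qed

text \<open>As \<open>x\<^sub>v\<close> lies in the \<open>j\<close>-th colon ideal, \<open>x\<^sub>v h\<^sub>j\<close> is a combination of the previous generators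
  up to an error in \<open>M \<inter> (x\<^sub>p, x\<^sub>q) F = (x\<^sub>p, x\<^sub>q) M\<close>. The error can be written with coefficients in the
  parameter ideal, and this lifts the relation modulo the parameters to a syzygy. Its linear part is
  again a syzygy.\<close>

lemma linear_syzygy_exists:
  assumes hom: "\<And>j l. j < b \<Longrightarrow> h j l \<in> homogeneous_polys n d"
    and M: "parameters_regular (poly_span n {..<b} h)"
    and j: "j < b" and V: "colon_generated_by V h j" and v: "v \<in> V"
  obtains w where "w \<in> syzygy_module n b h" "\<And>i. w i \<in> homogeneous_polys n 1"
    "w j - var v \<in> parameter_ideal" "\<And>i. i > j \<Longrightarrow> w i \<in> parameter_ideal"
proof -
  have R: "h i l \<in> poly_ring n" if "i < b" for i l
    using hom[OF that] by (rule homogeneous_polys_poly_ring)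
  let ?M = "poly_span n {..<b} h"
  have sub: "poly_submodule n ?M" by (rule poly_submodule_span) (auto intro: R)
  have v_n: "v \<in> {1..n}" using V v by (auto simp: colon_generated_by_def)
  then have "var v \<in> variable_ideal n V" "var v \<in> poly_ring n"
    using v by (auto intro: var_in_variable_ideal var_in_poly_ring)
  then obtain t where t: "t \<in> poly_span n {..<j} h" "param_congruent (\<lambda>l. var v * h j l) t"
    using V unfolding colon_generated_by_def by blast
  obtain c where c: "\<And>i. i < j \<Longrightarrow> c i \<in> poly_ring n" "\<And>l. t l = (\<Sum>i<j. c i * h i l)"
    using t(1) by (rule poly_spanE) blast
  have h_M: "h i \<in> ?M" if "i < b" for i using that by (intro generator_in_poly_span) auto
  have "t \<in> ?M"
    using poly_span_subset[OF sub, of "{..<j}" h] t(1) h_M j by force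
  then have "(\<lambda>l. var v * h j l - t l) \<in> ?M"
    using v_n j by (intro poly_submodule_diff[OF sub] poly_submodule_mult[OF sub] h_M var_in_poly_ring)
  moreover have "var v * h j l - t l \<in> parameter_ideal" for l
    using t(2) by (simp add: param_congruent_def)
  ultimately obtain x y where xy: "x \<in> ?M" "y \<in> ?M" 
    "\<And>l. var v * h j l - t l = var p * x l + var q * y l"
    by (rule parameters_regular_split[OF M]) blast
  obtain a where a: "\<And>i. i < b \<Longrightarrow> a i \<in> poly_ring n" "\<And>l. x l = (\<Sum>i<b. a i * h i l)"
    using xy(1) by (rule poly_spanE) blast
  obtain e where e: "\<And>i. i < b \<Longrightarrow> e i \<in> poly_ring n" "\<And>l. y l = (\<Sum>i<b. e i * h i l)"
    using xy(2) by (rule poly_spanE) blast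
  \<comment> \<open>the coefficients of \<open>x\<^sub>v h\<^sub>j - t - (x\<^sub>p x + x\<^sub>q y) = 0\<close>\<close>
  define w where "w i = (if i < b then (if i = j then var v else 0) - (if i < j then c i else 0)
      - (var p * a i + var q * e i) else 0)" for i
  have w: "w \<in> syzygy_module n b h"
  proof (rule syzygy_moduleI)
    fix l
    have 1: "(\<Sum>i<b. (if i = j then var v else 0) * h i l) = var v * h j l"
    proof -
      have "(\<Sum>i<b. (if i = j then var v else 0) * h i l) = (\<Sum>i<b. if i = j then var v * h i l else 0)"
        by (rule sum.cong) auto
      then show ?thesis using j by simp
    qed
    have 2: "(\<Sum>i<b. (if i < j then c i else 0) * h i l) = t l"
      unfolding c(2) by (rule sum.mono_neutral_cong_right) (use j in auto)
    have "(\<Sum>i<b. w i * h i l) = (var v * h j l - t l) - (var p * x l + var q * y l)"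
      unfolding a(2) e(2) 1[symmetric] 2[symmetric]
      by (simp add: w_def left_diff_distrib distrib_right sum_subtractf sum.distrib sum_distrib_left mult.assoc)
    then show "(\<Sum>i<b. w i * h i l) = 0" using xy(3) by simp
  qed (auto simp: w_def intro!: poly_ring_diff poly_ring_add poly_ring_mult poly_ring_uminus a e c
         var_in_poly_ring p_var q_var v_n)
  have pq: "var p * a i + var q * e i \<in> parameter_ideal" if "i < b" for i
    using a(1)[OF that] e(1)[OF that]
    by (intro variable_ideal_add variable_ideal_mult' var_in_variable_ideal p_var q_var) auto
  have wj: "w j - var v \<in> parameter_ideal"
    using variable_ideal_uminus[OF pq[OF j]] j by (simp add: w_def)
  have wi: "w i \<in> parameter_ideal" if "i > j" for i
    using variable_ideal_uminus[OF pq, of i] that by (auto simp: w_def)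
  show ?thesis
  proof (rule that)
    show "(\<lambda>i. degree_part {1} (w i)) \<in> syzygy_module n b h"
      by (rule syzygy_module_degree_part[OF hom w])
    show "degree_part {1} (w i) \<in> homogeneous_polys n 1" for i
      using syzygy_moduleD(1)[OF w] by (rule degree_part_in_homogeneous)
    show "degree_part {1} (w j) - var v \<in> parameter_ideal"
      using variable_ideal_degree_part[OF wj, of "{1}"]
      by (simp add: degree_part_diff degree_part_homogeneous[OF var_homogeneous[OF v_n]])
    show "degree_part {1} (w i) \<in> parameter_ideal" if "i > j" for i
      using wi[OF that] by (rule variable_ideal_degree_part)
  qed
qed

text \<open>The syzygies are filtered by the position \<open>j\<close> of the last coordinate outside the parameter
  ideal. That coordinate ranges over the \<open>j\<close>-th colon ideal, which is generated by variables, and an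
  ideal generated by variables has linear quotients itself: the colon ideal of \<open>(U)\<close> by a further
  variable is \<open>(U)\<close> again. So adjoining the linear syzygies of \<open>linear_syzygy_exists\<close>, first for small
  \<open>j\<close> and for each \<open>j\<close> one variable at a time, exhausts the syzygy module.\<close>

lemma linear_module_syzygies:
  assumes lq: "linear_quotients d b h" and M: "parameters_regular (poly_span n {..<b} h)"
  shows "linear_module 1 (syzygy_module n b h)"
proof -
  let ?S = "syzygy_module n b h"
  have hom: "h j l \<in> homogeneous_polys n d" if "j < b" for j l
    using lq that by (simp add: linear_quotients_def)
  have R: "h i l \<in> poly_ring n" if "i < b" for i l
    using hom[OF that] by (rule homogeneous_polys_poly_ring)
  have sub: "poly_submodule n ?S" by (rule poly_submodule_syzygy_module)
  \<comment> \<open>the syzygies that vanish modulo the parameters from position \<open>j\<close> on\<close>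
  define Q where "Q j = {s \<in> ?S. \<forall>i\<ge>j. s i \<in> parameter_ideal}" for j
  have "generated_with_linear_quotients 1 (Q j)" if "j \<le> b" for j
    using that
  proof (induction j)
    case 0
    have "param_congruent s (\<lambda>_. 0)" if "s \<in> Q 0" for s
      using that by (simp add: Q_def param_congruent_def)
    moreover have "(\<lambda>_. 0) \<in> poly_span n {..<0} h" by (rule poly_spanI[of _ "\<lambda>_. 0"]) auto
    ultimately show ?case
      unfolding generated_with_linear_quotients_def linear_quotients_def
      by (intro exI[of _ 0] exI[of _ h]) auto
  next
    case (Suc j)
    then have j: "j < b" by simp
    obtain V where V: "colon_generated_by V h j" using lq j by (auto simp: linear_quotients_def)
    then have V_sub: "{p, q} \<subseteq> V" "V \<subseteq> {1..n}" by (auto simp: colon_generated_by_def)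
    \<comment> \<open>the steps between \<open>Q j\<close> and \<open>Q (Suc j)\<close>, for \<open>U\<close> between the empty set and \<open>V\<close>\<close>
    define Q' where "Q' U = {s \<in> ?S. s j \<in> variable_ideal n ({p, q} \<union> U) \<and>
        (\<forall>i>j. s i \<in> parameter_ideal)}" for U
    have sub_Q': "poly_submodule n (Q' U)" for U
      using sub unfolding poly_submodule_def Q'_def
      by (auto intro!: variable_ideal_add variable_ideal_mult)
    have gen_Q': "generated_with_linear_quotients 1 (Q' U)" if "finite U" "U \<subseteq> V - {p, q}" for U
      using that
    proof (induction U rule: finite_induct)
      case empty
      have "Q' {} = Q j" unfolding Q'_def Q_def by (auto simp: le_less)
      then show ?case using Suc by simp
    next
      case (insert v U)
      then have v: "v \<in> V" "v \<notin> {p, q} \<union> U" by auto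
      obtain w where w: "w \<in> ?S" "\<And>i. w i \<in> homogeneous_polys n 1"
        "w j - var v \<in> parameter_ideal" "\<And>i. i > j \<Longrightarrow> w i \<in> parameter_ideal"
        using linear_syzygy_exists[OF hom M j V v(1)] by blast
      have v_n: "v \<in> {1..n}" using V_sub v by auto
      have small: "x \<in> variable_ideal n ({p, q} \<union> U)" if "x \<in> parameter_ideal" for x :: "'a mpol"
        using that by (rule variable_ideal_mono) auto
      show ?case
      proof (rule generated_with_linear_quotients_extend[where h = w and V = "{p, q} \<union> U"])
        show "generated_with_linear_quotients 1 (Q' U)" using insert by auto
        show "poly_submodule n (Q' U)" by (rule sub_Q')
        show "Q' U \<subseteq> Q' (insert v U)"
          unfolding Q'_def by (auto intro: variable_ideal_mono)
        have "var v + (w j - var v) \<in> variable_ideal n ({p, q} \<union> insert v U)"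
          using w(3) v_n by (intro variable_ideal_add var_in_variable_ideal) (auto intro: variable_ideal_mono)
        then show "w \<in> Q' (insert v U)" using w by (simp add: Q'_def)
        show "w l \<in> homogeneous_polys n 1" for l by (rule w)
        show "{p, q} \<subseteq> {p, q} \<union> U" "{p, q} \<union> U \<subseteq> {1..n}" using V_sub insert by auto
        show "(\<lambda>l. r * w l) \<in> Q' U" if r: "r \<in> variable_ideal n ({p, q} \<union> U)" for r
        proof -
          have "r \<in> poly_ring n" using r by (rule variable_ideal_poly_ring)
          moreover have "r * w j \<in> variable_ideal n ({p, q} \<union> U)"
            using r syzygy_moduleD(1)[OF w(1)] by (rule variable_ideal_mult')
          ultimately show ?thesis
            using w unfolding Q'_def by (auto intro!: poly_submodule_mult[OF sub] variable_ideal_mult)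
        qed
        show "r \<in> variable_ideal n ({p, q} \<union> U)"
          if r: "r \<in> poly_ring n" and s: "s \<in> Q' U" "param_congruent (\<lambda>l. r * w l) s" for r s
        proof -
          have "r * w j - s j \<in> variable_ideal n ({p, q} \<union> U)"
            using s(2) by (intro small) (simp add: param_congruent_def)
          moreover have "s j \<in> variable_ideal n ({p, q} \<union> U)" using s(1) by (simp add: Q'_def)
          moreover have "r * (w j - var v) \<in> variable_ideal n ({p, q} \<union> U)"
            using r w(3) by (intro variable_ideal_mult small)
          ultimately have "((r * w j - s j) + s j) - r * (w j - var v) \<in> variable_ideal n ({p, q} \<union> U)"
            using variable_ideal_diff[OF variable_ideal_add] by blast
          then have "var v * r \<in> variable_ideal n ({p, q} \<union> U)" by (simp add: algebra_simps)
          \<comment> \<open>primality: \<open>x\<^sub>v\<close> is not among the generating variables\<close>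
          then show ?thesis using r v(2) by (rule variable_ideal_cancel_var)
        qed
        show "\<exists>r\<in>poly_ring n. (\<lambda>l. s l - r * w l) \<in> Q' U" if s: "s \<in> Q' (insert v U)" for s
        proof -
          have "s j \<in> variable_ideal n (insert v ({p, q} \<union> U))" using s by (simp add: Q'_def insert_commute)
          then obtain r x where r: "r \<in> poly_ring n" "x \<in> variable_ideal n ({p, q} \<union> U)" "s j = var v * r + x"
            by (rule variable_ideal_insertE)
          have "x - r * (w j - var v) \<in> variable_ideal n ({p, q} \<union> U)"
            using variable_ideal_diff[OF r(2) variable_ideal_mult[OF r(1) small[OF w(3)]]] .
          then have "s j - r * w j \<in> variable_ideal n ({p, q} \<union> U)" by (simp add: r(3) algebra_simps)
          moreover have "(\<lambda>l. s l - r * w l) \<in> ?S"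
            using s r(1) w(1) by (intro poly_submodule_diff[OF sub] poly_submodule_mult[OF sub]) (simp_all add: Q'_def)
          moreover have "s i - r * w i \<in> parameter_ideal" if "i > j" for i
            using s r(1) w(4)[OF that] that by (intro variable_ideal_diff variable_ideal_mult) (simp_all add: Q'_def)
          ultimately show ?thesis using r(1) by (intro bexI[of _ r]) (simp_all add: Q'_def)
        qed
      qed
    qed
    have "finite (V - {p, q})" using V_sub(2) by (rule finite_subset[THEN finite_Diff]) simp
    then have "generated_with_linear_quotients 1 (Q' (V - {p, q}))" by (rule gen_Q') simp
    moreover have "Q' (V - {p, q}) = Q (Suc j)"
    proof
      show "Q' (V - {p, q}) \<subseteq> Q (Suc j)" unfolding Q'_def Q_def by auto
      \<comment> \<open>the \<open>j\<close>-th coordinate of such a syzygy lies in the \<open>j\<close>-th colon ideal by the syzygy equation\<close>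
      show "Q (Suc j) \<subseteq> Q' (V - {p, q})"
      proof
        fix s assume s: "s \<in> Q (Suc j)"
        then have s_S: "s \<in> ?S" by (simp add: Q_def)
        define t where "t l = (\<Sum>i<j. (- s i) * h i l)" for l
        have "t \<in> poly_span n {..<j} h"
          using syzygy_moduleD(1)[OF s_S] by (intro poly_spanI[of _ "\<lambda>i. - s i"]) (auto simp: t_def poly_ring_uminus)
        moreover have "param_congruent (\<lambda>l. s j * h j l) t"
          unfolding param_congruent_def
        proof
          fix l
          have "{..<b} = {..<Suc j} \<union> {Suc j..<b}" using j by auto
          then have "0 = (\<Sum>i\<in>{..<Suc j} \<union> {Suc j..<b}. s i * h i l)"
            using syzygy_moduleD(3)[OF s_S, of l] by simp
          also have "\<dots> = (s j * h j l - t l) + (\<Sum>i\<in>{Suc j..<b}. s i * h i l)"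
            by (subst sum.union_disjoint) (auto simp: t_def sum_negf)
          finally have "s j * h j l - t l = - (\<Sum>i\<in>{Suc j..<b}. s i * h i l)"
            by (simp add: eq_neg_iff_add_eq_0)
          also have "\<dots> \<in> parameter_ideal"
            using s R by (intro variable_ideal_uminus variable_ideal_sum variable_ideal_mult') (auto simp: Q_def)
          finally show "s j * h j l - t l \<in> parameter_ideal" .
        qed
        ultimately have "s j \<in> variable_ideal n V"
          using V syzygy_moduleD(1)[OF s_S, of j] unfolding colon_generated_by_def by blast
        moreover have "{p, q} \<union> (V - {p, q}) = V" using V_sub by auto
        ultimately show "s \<in> Q' (V - {p, q})" using s by (simp add: Q'_def Q_def)
      qed
    qed
    ultimately show ?case by simp
  qed
  moreover have "Q b = ?S" unfolding Q_def by (auto dest: syzygy_moduleD(2))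
  ultimately have "generated_with_linear_quotients 1 ?S" by fastforce
  moreover have "\<exists>N. \<forall>l. degree_part {..<N} (v l) = v l" if "v \<in> ?S" for v
  proof -
    obtain N where "\<forall>l\<in>{..<b}. degree_part {..<N} (v l) = v l"
      using degree_part_large[of "{..<b}" v] by auto
    then have "\<forall>l. degree_part {..<N} (v l) = v l"
      using syzygy_moduleD(2)[OF that] by (metis degree_part_0 lessThan_iff not_less)
    then show ?thesis ..
  qed
  moreover have "parameters_regular ?S"
    by (rule parameters_regular_syzygy_module[OF R M])
  ultimately show ?thesis using nakayama_homogeneous[OF sub] by blast
qed

end

section \<open>Change of minimal generators and minimal resolutions\<close>

lemma homogeneous_0_variable_ideal:
  "p \<in> homogeneous_polys n 0 \<Longrightarrow> p \<in> variable_ideal n V \<Longrightarrow> p = 0"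
  by (auto simp: homogeneous_polys_def variable_ideal_def monomial_span_def mono_deg_eq_0_iff
      simp flip: keys_eq_empty)

lemma homogeneous_polys_diff:
  "p \<in> homogeneous_polys n d \<Longrightarrow> q \<in> homogeneous_polys n d \<Longrightarrow> p - q \<in> homogeneous_polys n d"
  unfolding homogeneous_polys_def by (rule monomial_span_diff)

lemma minimal_generator_not_redundant:
  assumes "minimal_hom_generators n e M b e' g" "j < b"
  shows "g j \<notin> poly_span n ({..<b} - {j}) g"
proof
  assume "g j \<in> poly_span n ({..<b} - {j}) g"
  then obtain c where c: "\<And>i. i \<in> {..<b} - {j} \<Longrightarrow> c i \<in> poly_ring n"
    "\<And>l. g j l = (\<Sum>i\<in>{..<b} - {j}. c i * g i l)"
    by (rule poly_spanE) blast
  have split: "(\<Sum>i<b. f i) = f j + (\<Sum>i\<in>{..<b} - {j}. f i)" for f :: "nat \<Rightarrow> 'a mpol"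
    using assms(2) by (simp add: sum.remove)
  have "poly_span n ({..<b} - {j}) g = poly_span n {..<b} g"
  proof (intro equalityI subsetI)
    fix v assume "v \<in> poly_span n ({..<b} - {j}) g"
    then obtain a where a: "\<And>i. i \<in> {..<b} - {j} \<Longrightarrow> a i \<in> poly_ring n"
      "\<And>l. v l = (\<Sum>i\<in>{..<b} - {j}. a i * g i l)"
      by (rule poly_spanE) blast
    then show "v \<in> poly_span n {..<b} g"
      by (intro poly_spanI[of _ "a(j := 0)"]) (auto simp: split)
  next
    fix v assume "v \<in> poly_span n {..<b} g"
    then obtain a where a: "\<And>i. i \<in> {..<b} \<Longrightarrow> a i \<in> poly_ring n" "\<And>l. v l = (\<Sum>i<b. a i * g i l)"
      by (rule poly_spanE) blast
    have "v l = (\<Sum>i\<in>{..<b} - {j}. (a j * c i + a i) * g i l)" for l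
      unfolding a(2) split c(2) by (simp add: distrib_right sum.distrib sum_distrib_left mult.assoc)
    then show "v \<in> poly_span n ({..<b} - {j}) g"
      using a(1) c(1) assms(2)
      by (intro poly_spanI[of _ "\<lambda>i. a j * c i + a i"]) (auto intro!: poly_ring_add poly_ring_mult)
  qed
  then show False
    using assms unfolding minimal_hom_generators_def by (metis Diff_subset Diff_iff lessThan_iff
        psubsetI singletonI)
qed

text \<open>A scalar relation can be solved for any generator that has a nonzero coefficient.\<close>

lemma minimal_generators_independent:
  assumes "minimal_hom_generators n e M b e' g"
    and a: "\<And>j. j < b \<Longrightarrow> a j \<in> homogeneous_polys n 0"
    and rel: "\<And>l. (\<Sum>j<b. a j * g j l) = 0" and "i < b"
  shows "a i = 0"
proof (rule ccontr)
  assume "a i \<noteq> 0"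
  define c where "c = Poly_Mapping.lookup (a i) 0"
  have ai: "a i = Poly_Mapping.single 0 c" unfolding c_def using a[OF \<open>i < b\<close>] by (rule homogeneous_0_scalar)
  with \<open>a i \<noteq> 0\<close> have "c \<noteq> 0" by auto
  let ?u = "Poly_Mapping.single 0 (- inverse c) :: 'a mpol"
  have u: "?u * a i = - 1" using \<open>c \<noteq> 0\<close> by (simp add: ai mult_single single_uminus)
  have "g i l = (\<Sum>j\<in>{..<b} - {i}. (?u * a j) * g j l)" for l
  proof -
    have "0 = ?u * (a i * g i l + (\<Sum>j\<in>{..<b} - {i}. a j * g j l))"
      using rel[of l] \<open>i < b\<close> by (simp add: sum.remove)
    also have "\<dots> = - g i l + (\<Sum>j\<in>{..<b} - {i}. (?u * a j) * g j l)"
      using u by (simp add: distrib_left sum_distrib_left mult.assoc[symmetric])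
    finally show ?thesis by simp
  qed
  then have "g i \<in> poly_span n ({..<b} - {i}) g"
    by (intro poly_spanI[of _ "\<lambda>j. ?u * a j"])
      (auto intro!: poly_ring_mult homogeneous_polys_poly_ring[OF a])
  then show False using minimal_generator_not_redundant[OF assms(1) \<open>i < b\<close>] by simp
qed

text \<open>A matrix acting on row vectors, with results cut off at \<open>b\<close> so that they belong to the free
  module of rank \<open>b\<close>.\<close>

definition matrix_map ::
    "nat \<Rightarrow> nat \<Rightarrow> (nat \<Rightarrow> nat \<Rightarrow> 'k::field mpol) \<Rightarrow> (nat \<Rightarrow> 'k mpol) \<Rightarrow> nat \<Rightarrow> 'k mpol" where
  "matrix_map m b A c = (\<lambda>j. if j < b then \<Sum>i<m. c i * A i j else 0)"

lemma matrix_map_sum: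
  "matrix_map m b A (\<lambda>l. \<Sum>k\<in>I. r k * v k l) = (\<lambda>l. \<Sum>k\<in>I. r k * matrix_map m b A (v k) l)"
proof
  fix l
  have "(\<Sum>i<m. (\<Sum>k\<in>I. r k * v k i) * A i l) = (\<Sum>k\<in>I. r k * (\<Sum>i<m. v k i * A i l))"
    unfolding sum_distrib_left sum_distrib_right by (subst sum.swap) (simp add: mult.assoc)
  then show "matrix_map m b A (\<lambda>l. \<Sum>k\<in>I. r k * v k l) l = (\<Sum>k\<in>I. r k * matrix_map m b A (v k) l)"
    by (simp add: matrix_map_def)
qed

lemma matrix_map_mult: "matrix_map m b A (\<lambda>l. r * v l) = (\<lambda>l. r * matrix_map m b A v l)"
  by (auto simp: matrix_map_def sum_distrib_left mult.assoc)

lemma matrix_map_inverse: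
  assumes AB: "\<And>i i'. i < m \<Longrightarrow> i' < m \<Longrightarrow> (\<Sum>j<b. A i j * B j i') = (if i = i' then 1 else 0)"
    and c: "\<And>i. i \<ge> m \<Longrightarrow> c i = 0"
  shows "matrix_map b m B (matrix_map m b A c) = c"
proof
  fix i'
  show "matrix_map b m B (matrix_map m b A c) i' = c i'"
  proof (cases "i' < m")
    case True
    have "(\<Sum>j<b. (\<Sum>i<m. c i * A i j) * B j i') = (\<Sum>i<m. c i * (\<Sum>j<b. A i j * B j i'))"
      unfolding sum_distrib_left sum_distrib_right by (subst sum.swap) (simp add: mult.assoc)
    also have "\<dots> = (\<Sum>i<m. if i = i' then c i else 0)"
      using True by (intro sum.cong) (auto simp: AB)
    also have "\<dots> = c i'" using True by simp
    finally show ?thesis using True by (simp add: matrix_map_def)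
  qed (simp add: c matrix_map_def)
qed

lemma matrix_map_syzygy:
  assumes c: "c \<in> syzygy_module n m h" and A: "\<And>i j. i < m \<Longrightarrow> j < b \<Longrightarrow> A i j \<in> poly_ring n"
    and h: "\<And>i l. i < m \<Longrightarrow> h i l = (\<Sum>j<b. A i j * g j l)"
  shows "matrix_map m b A c \<in> syzygy_module n b g"
proof (rule syzygy_moduleI)
  fix l
  have "(\<Sum>j<b. matrix_map m b A c j * g j l) = (\<Sum>j<b. (\<Sum>i<m. c i * A i j) * g j l)"
    by (simp add: matrix_map_def)
  also have "\<dots> = (\<Sum>i<m. c i * h i l)"
    unfolding sum_distrib_right by (subst sum.swap) (simp add: h mult.assoc sum_distrib_left)
  finally show "(\<Sum>j<b. matrix_map m b A c j * g j l) = 0"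
    using syzygy_moduleD(3)[OF c] by simp
next
  show "matrix_map m b A c j \<in> poly_ring n" for j
    using syzygy_moduleD(1)[OF c] A by (auto simp: matrix_map_def intro!: poly_ring_sum poly_ring_mult)
qed (simp add: matrix_map_def)

context two_parameters
begin

text \<open>In a scalar relation, the last nonzero coefficient would be a unit in a colon ideal, but
  those ideals are proper since they are generated by variables.\<close>

lemma linear_quotients_independent:
  assumes lq: "linear_quotients d m h"
    and a: "\<And>j. j < m \<Longrightarrow> a j \<in> homogeneous_polys n 0"
    and rel: "\<And>l. (\<Sum>j<m. a j * h j l) = 0" and "i < m"
  shows "a i = 0"
proof (rule ccontr)
  assume "a i \<noteq> 0"
  define j where "j = Max {j. j < m \<and> a j \<noteq> 0}"
  have fin: "finite {j. j < m \<and> a j \<noteq> 0}" by simp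
  have ne: "{j. j < m \<and> a j \<noteq> 0} \<noteq> {}" using \<open>a i \<noteq> 0\<close> \<open>i < m\<close> by auto
  have j: "j < m" "a j \<noteq> 0" using Max_in[OF fin ne] by (auto simp: j_def)
  have above: "a k = 0" if "k < m" "k > j" for k
  proof (rule ccontr)
    assume "a k \<noteq> 0"
    then have "k \<le> j" unfolding j_def using \<open>k < m\<close> by (intro Max_ge[OF fin]) simp
    then show False using \<open>k > j\<close> by simp
  qed
  obtain V where V: "colon_generated_by V h j" using lq j by (auto simp: linear_quotients_def)
  have "a j * h j l = (\<Sum>k<j. (- a k) * h k l)" for l
  proof -
    have "(\<Sum>k<m. a k * h k l) = (\<Sum>k<Suc j. a k * h k l)"
      using j above by (intro sum.mono_neutral_right) auto
    then show ?thesis using rel[of l] by (simp add: sum_negf add_eq_0_iff)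
  qed
  then have "(\<lambda>l. a j * h j l) \<in> poly_span n {..<j} h"
    using j by (intro poly_spanI[of _ "\<lambda>k. - a k"])
      (auto intro!: poly_ring_uminus homogeneous_polys_poly_ring[OF a])
  then have "a j \<in> variable_ideal n V"
    using V homogeneous_polys_poly_ring[OF a[OF j(1)]] unfolding colon_generated_by_def
    using param_congruent_refl by blast
  with a[OF j(1)] j(2) show False using homogeneous_0_variable_ideal by blast
qed

text \<open>If some \<open>h j\<close> were redundant, the degree-\<open>d\<close> part of the equation expressing it would be a
  scalar relation.\<close>

lemma linear_quotients_minimal_generators:
  assumes lq: "linear_quotients d m h"
    and supp: "\<And>v l. v \<in> poly_span n {..<m} h \<Longrightarrow> v l \<noteq> 0 \<Longrightarrow> e l = E"
  shows "minimal_hom_generators n e (poly_span n {..<m} h) m (\<lambda>_. E + d) h"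
  unfolding minimal_hom_generators_def
proof (intro conjI allI impI)
  have hom: "h j l \<in> homogeneous_polys n d" if "j < m" for j l
    using lq that by (simp add: linear_quotients_def)
  have h_span: "h j \<in> poly_span n {..<m} h" if "j < m" for j
    using that by (intro generator_in_poly_span) auto
  show "homogeneous_vec e (E + d) (h j)" if "j < m" for j
    unfolding homogeneous_vec_def
  proof (intro allI ballI)
    fix l x assume x: "x \<in> Poly_Mapping.keys (h j l)"
    then have "h j l \<noteq> 0" by auto
    then have "e l = E" by (rule supp[OF h_span[OF that]])
    moreover have "mono_deg x = d"
      using hom[OF that, of l] x by (simp add: homogeneous_polys_def monomial_span_def)
    ultimately show "mono_deg x + e l = E + d" by simp
  qed
  show "poly_span n J h \<noteq> poly_span n {..<m} h" if J: "J \<subset> {..<m}" for J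
  proof
    assume eq: "poly_span n J h = poly_span n {..<m} h"
    obtain j where j: "j < m" "j \<notin> J" using J by auto
    have "finite J" using J finite_subset by blast
    have "h j \<in> poly_span n J h" using h_span[OF j(1)] eq by simp
    then obtain c where c: "\<And>i. i \<in> J \<Longrightarrow> c i \<in> poly_ring n" "\<And>l. h j l = (\<Sum>i\<in>J. c i * h i l)"
      by (rule poly_spanE) blast
    define a where "a i = (if i = j then 1 else if i \<in> J then - degree_part {0} (c i) else 0)" for i
    have "a j = 0"
    proof (rule linear_quotients_independent[OF lq])
      fix l
      have "h j l = degree_part {d} (h j l)"
        using hom[OF j(1), of l] by (simp add: degree_part_homogeneous)
      also have "\<dots> = (\<Sum>i\<in>J. degree_part {0} (c i) * h i l)"
        unfolding c(2) degree_part_sum using J hom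
        by (intro sum.cong refl degree_part_mult[where n = n and d = d]) auto
      finally have hj: "h j l = (\<Sum>i\<in>J. degree_part {0} (c i) * h i l)" .
      have "(\<Sum>i<m. a i * h i l) = (\<Sum>i\<in>insert j J. a i * h i l)"
        using J j by (intro sum.mono_neutral_right) (auto simp: a_def)
      also have "\<dots> = h j l + (\<Sum>i\<in>J. - degree_part {0} (c i) * h i l)"
        using \<open>finite J\<close> j(2) by (simp add: a_def) (intro sum.cong, auto)
      also have "\<dots> = 0" by (subst hj) (simp add: sum_negf)
      finally show "(\<Sum>i<m. a i * h i l) = 0" .
    next
      have "1 \<in> homogeneous_polys n 0"
        by (simp add: homogeneous_polys_def monomial_span_def)
      moreover have "- degree_part {0} x \<in> homogeneous_polys n 0" if "x \<in> poly_ring n" for x :: "'a mpol"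
        using degree_part_in_homogeneous[OF that] unfolding homogeneous_polys_def by (rule monomial_span_uminus)
      ultimately show "a i \<in> homogeneous_polys n 0" if "i < m" for i
        using c(1) by (auto simp: a_def homogeneous_polys_def)
    qed (rule j)
    then show False by (simp add: a_def)
  qed
qed simp

text \<open>Let \<open>\<delta> j\<close> be the degree of the entries of \<open>g j\<close>. Degree reasons give \<open>\<delta> j \<ge> d\<close>, because \<open>g j\<close> is a
  nonzero combination of the \<open>h i\<close>. If \<open>\<delta> j > d\<close>, the \<open>h i\<close> could not involve \<open>g j\<close>, which would
  therefore be a combination of the other generators. So both systems live in the same degree, the
  transition matrices are scalar, and independence over the field makes them inverse to each other.\<close>

lemma change_of_minimal_generators:
  assumes lq: "linear_quotients d m h" and M: "M = poly_span n {..<m} h"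
    and g: "minimal_hom_generators n e M b e' g"
    and supp': "\<forall>v\<in>M. \<forall>l. v l \<noteq> 0 \<longrightarrow> e l = E"
  obtains A B where "\<And>j. j < b \<Longrightarrow> e' j = E + d"
    "\<And>i j. i < m \<Longrightarrow> j < b \<Longrightarrow> A i j \<in> homogeneous_polys n 0"
    "\<And>i j. i < m \<Longrightarrow> j < b \<Longrightarrow> B j i \<in> homogeneous_polys n 0"
    "\<And>i l. i < m \<Longrightarrow> h i l = (\<Sum>j<b. A i j * g j l)"
    "\<And>j l. j < b \<Longrightarrow> g j l = (\<Sum>i<m. B j i * h i l)"
    "\<And>i i'. i < m \<Longrightarrow> i' < m \<Longrightarrow> (\<Sum>j<b. A i j * B j i') = (if i = i' then 1 else 0)"
    "\<And>j j'. j < b \<Longrightarrow> j' < b \<Longrightarrow> (\<Sum>i<m. B j i * A i j') = (if j = j' then 1 else 0)"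
proof -
  have supp: "e l = E" if "v \<in> M" "v l \<noteq> 0" for v l using supp' that by blast
  have hom: "h j l \<in> homogeneous_polys n d" if "j < m" for j l
    using lq that by (simp add: linear_quotients_def)
  have sub: "poly_submodule n M"
    unfolding M by (rule poly_submodule_span) (auto intro: homogeneous_polys_poly_ring[OF hom])
  have M_g: "M = poly_span n {..<b} g" using g by (simp add: minimal_hom_generators_def)
  have g_M: "g j \<in> M" if "j < b" for j
    unfolding M_g using that by (intro generator_in_poly_span) auto
  have h_M: "h i \<in> M" if "i < m" for i
    unfolding M using that by (intro generator_in_poly_span) auto
  have sub': "poly_submodule n (poly_span n ({..<b} - {j}) g)" for j
    by (rule poly_submodule_span) (auto intro: poly_submodule_poly_ring[OF sub g_M])
  define \<delta> where "\<delta> j = e' j - E" for j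
  have g_hom: "g j l \<in> homogeneous_polys n (\<delta> j)" if j: "j < b" for j l
  proof -
    have "mono_deg x = \<delta> j" if "x \<in> Poly_Mapping.keys (g j l)" for x
    proof -
      have "g j l \<noteq> 0" using that by auto
      then have "e l = E" by (rule supp[OF g_M[OF j]])
      then show ?thesis
        using g j that unfolding minimal_hom_generators_def homogeneous_vec_def \<delta>_def
        by (metis add_diff_cancel_right')
    qed
    then show ?thesis
      using poly_submodule_poly_ring[OF sub g_M[OF j]] by (simp add: homogeneous_polys_def monomial_span_def)
  qed
  have g_nonzero: "\<exists>l. g j l \<noteq> 0" if j: "j < b" for j
  proof (rule ccontr)
    assume "\<nexists>l. g j l \<noteq> 0"
    then have "g j = (\<lambda>_. 0)" by auto
    then show False
      using poly_submodule_0[OF sub'] minimal_generator_not_redundant[OF g j] by simp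
  qed
  have e'_eq: "e' j = E + \<delta> j" if j: "j < b" for j
  proof -
    obtain l where l: "g j l \<noteq> 0" using g_nonzero[OF j] by blast
    then obtain x where "x \<in> Poly_Mapping.keys (g j l)" by (metis ex_in_conv keys_eq_empty)
    then have "mono_deg x + e l = e' j"
      using g j unfolding minimal_hom_generators_def homogeneous_vec_def by blast
    moreover have "e l = E" using supp[OF g_M[OF j] l] .
    ultimately show ?thesis by (simp add: \<delta>_def)
  qed
  have "\<forall>j. \<exists>c. j < b \<longrightarrow> (\<forall>i<m. c i \<in> poly_ring n) \<and> (\<forall>l. g j l = (\<Sum>i<m. c i * h i l))"
  proof
    fix j
    show "\<exists>c. j < b \<longrightarrow> (\<forall>i<m. c i \<in> poly_ring n) \<and> (\<forall>l. g j l = (\<Sum>i<m. c i * h i l))"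
    proof (cases "j < b")
      case True
      then have "g j \<in> poly_span n {..<m} h" using g_M M by simp
      then show ?thesis by (rule poly_spanE) (metis lessThan_iff)
    qed simp
  qed
  then obtain c where c: "\<And>j i. j < b \<Longrightarrow> i < m \<Longrightarrow> c j i \<in> poly_ring n"
    "\<And>j l. j < b \<Longrightarrow> g j l = (\<Sum>i<m. c j i * h i l)" by metis
  have "\<forall>i. \<exists>a. i < m \<longrightarrow> (\<forall>j<b. a j \<in> poly_ring n) \<and> (\<forall>l. h i l = (\<Sum>j<b. a j * g j l))"
  proof
    fix i
    show "\<exists>a. i < m \<longrightarrow> (\<forall>j<b. a j \<in> poly_ring n) \<and> (\<forall>l. h i l = (\<Sum>j<b. a j * g j l))"
    proof (cases "i < m")
      case True
      then have "h i \<in> poly_span n {..<b} g" using h_M M_g by simp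
      then show ?thesis by (rule poly_spanE) (metis lessThan_iff)
    qed simp
  qed
  then obtain a where a: "\<And>i j. i < m \<Longrightarrow> j < b \<Longrightarrow> a i j \<in> poly_ring n"
    "\<And>i l. i < m \<Longrightarrow> h i l = (\<Sum>j<b. a i j * g j l)" by metis
  have g_part: "g j l = (\<Sum>i<m. degree_part {x. x + d = \<delta> j} (c j i) * h i l)" if j: "j < b" for j l
  proof -
    have "g j l = degree_part {\<delta> j} (g j l)"
      using g_hom[OF j, of l] by (simp add: degree_part_homogeneous)
    also have "\<dots> = (\<Sum>i<m. degree_part {x. x + d = \<delta> j} (c j i) * h i l)"
      unfolding c(2)[OF j] degree_part_sum using hom
      by (intro sum.cong refl degree_part_mult[where n = n and d = d]) auto
    finally show ?thesis .
  qed
  have h_part: "h i l = (\<Sum>j<b. degree_part {x. x + \<delta> j = d} (a i j) * g j l)" if i: "i < m" for i l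
  proof -
    have "h i l = degree_part {d} (h i l)"
      using hom[OF i, of l] by (simp add: degree_part_homogeneous)
    also have "\<dots> = (\<Sum>j<b. degree_part {x. x + \<delta> j = d} (a i j) * g j l)"
      unfolding a(2)[OF i] degree_part_sum using g_hom
      by (intro sum.cong refl degree_part_mult[where n = n]) auto
    finally show ?thesis .
  qed
  have \<delta>: "\<delta> j = d" if j: "j < b" for j
  proof (rule antisym)
    show "d \<le> \<delta> j"
    proof (rule ccontr)
      assume "\<not> d \<le> \<delta> j"
      then have "{x. x + d = \<delta> j} = {}" by auto
      then have "g j l = 0" for l using g_part[OF j, of l] by simp
      then show False using g_nonzero[OF j] by blast
    qed
    show "\<delta> j \<le> d"
    proof (rule ccontr)
      assume "\<not> \<delta> j \<le> d"
      then have empty: "{x. x + \<delta> j = d} = {}" by auto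
      have "h i \<in> poly_span n ({..<b} - {j}) g" if i: "i < m" for i
      proof (rule poly_spanI)
        show "h i l = (\<Sum>k\<in>{..<b} - {j}. degree_part {x. x + \<delta> k = d} (a i k) * g k l)" for l
          using h_part[OF i, of l] j empty by (simp add: sum.remove)
      qed (auto intro!: poly_ring_degree_part a i)
      then have "poly_span n {..<m} h \<subseteq> poly_span n ({..<b} - {j}) g"
        by (intro poly_span_subset sub') auto
      then show False
        using minimal_generator_not_redundant[OF g j] g_M[OF j] M by blast
    qed
  qed
  define A where "A i j = degree_part {0} (a i j)" for i j
  define B where "B j i = degree_part {0} (c j i)" for j i
  have A0: "A i j \<in> homogeneous_polys n 0" if "i < m" "j < b" for i j
    using a(1)[OF that] by (simp add: A_def degree_part_in_homogeneous)
  have B0: "B j i \<in> homogeneous_polys n 0" if "i < m" "j < b" for i j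
    using c(1)[OF that(2,1)] by (simp add: B_def degree_part_in_homogeneous)
  have hA: "h i l = (\<Sum>j<b. A i j * g j l)" if "i < m" for i l
    using h_part[OF that, of l] by (simp add: \<delta> A_def)
  have gB: "g j l = (\<Sum>i<m. B j i * h i l)" if "j < b" for j l
    using g_part[OF that, of l] by (simp add: \<delta>[OF that] B_def)
  have one: "(if P then 1 else 0) \<in> homogeneous_polys n 0" for P
    by (simp add: homogeneous_polys_def monomial_span_def)
  have mult0: "x * y \<in> homogeneous_polys n 0"
    if "x \<in> homogeneous_polys n 0" "y \<in> homogeneous_polys n 0" for x y :: "'a mpol"
    using homogeneous_polys_mult[OF that] by simp
  have AB: "(\<Sum>j<b. A i j * B j i') = (if i = i' then 1 else 0)" if i: "i < m" "i' < m" for i i'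
  proof -
    let ?x = "\<lambda>i'. (\<Sum>j<b. A i j * B j i') - (if i = i' then 1 else 0)"
    have "?x i' = 0"
    proof (rule linear_quotients_independent[OF lq _ _ i(2)])
      show "?x k \<in> homogeneous_polys n 0" if "k < m" for k
        by (intro homogeneous_polys_diff homogeneous_polys_sum mult0 A0 B0 one) (use i that in auto)
      fix l
      have "(\<Sum>k<m. (if i = k then 1 else 0) * h k l) = (\<Sum>k<m. if i = k then h k l else 0)"
        by (rule sum.cong) auto
      also have "\<dots> = h i l" using i by simp
      finally have 1: "(\<Sum>k<m. (if i = k then 1 else 0) * h k l) = h i l" .
      have "(\<Sum>k<m. (\<Sum>j<b. A i j * B j k) * h k l) = (\<Sum>j<b. A i j * (\<Sum>k<m. B j k * h k l))"
        unfolding sum_distrib_left sum_distrib_right by (subst sum.swap) (simp add: mult.assoc)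
      also have "\<dots> = (\<Sum>j<b. A i j * g j l)" by (intro sum.cong) (simp_all add: gB)
      also have "\<dots> = h i l" using i by (simp add: hA)
      finally show "(\<Sum>k<m. ?x k * h k l) = 0" using 1 by (simp add: left_diff_distrib sum_subtractf)
    qed
    then show ?thesis by simp
  qed
  have BA: "(\<Sum>i<m. B j i * A i j') = (if j = j' then 1 else 0)" if j: "j < b" "j' < b" for j j'
  proof -
    let ?x = "\<lambda>j'. (\<Sum>i<m. B j i * A i j') - (if j = j' then 1 else 0)"
    have "?x j' = 0"
    proof (rule minimal_generators_independent[OF g _ _ j(2)])
      show "?x k \<in> homogeneous_polys n 0" if "k < b" for k
        by (intro homogeneous_polys_diff homogeneous_polys_sum mult0 A0 B0 one) (use j that in auto)
      fix l
      have "(\<Sum>k<b. (if j = k then 1 else 0) * g k l) = (\<Sum>k<b. if j = k then g k l else 0)"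
        by (rule sum.cong) auto
      also have "\<dots> = g j l" using j by simp
      finally have 1: "(\<Sum>k<b. (if j = k then 1 else 0) * g k l) = g j l" .
      have "(\<Sum>k<b. (\<Sum>i<m. B j i * A i k) * g k l) = (\<Sum>i<m. B j i * (\<Sum>k<b. A i k * g k l))"
        unfolding sum_distrib_left sum_distrib_right by (subst sum.swap) (simp add: mult.assoc)
      also have "\<dots> = (\<Sum>i<m. B j i * h i l)" by (intro sum.cong) (simp_all add: hA)
      also have "\<dots> = g j l" using j by (simp add: gB)
      finally show "(\<Sum>k<b. ?x k * g k l) = 0" using 1 by (simp add: left_diff_distrib sum_subtractf)
    qed
    then show ?thesis by simp
  qed
  show ?thesis
    using that[of A B] A0 B0 hA gB AB BA e'_eq \<delta> by simp
qed

lemma param_congruent_matrix_map: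
  assumes "param_congruent u v" "\<And>i j. i < m \<Longrightarrow> j < b \<Longrightarrow> A i j \<in> poly_ring n"
  shows "param_congruent (matrix_map m b A u) (matrix_map m b A v)"
  unfolding param_congruent_def
proof
  fix j
  have "(\<Sum>i<m. u i * A i j) - (\<Sum>i<m. v i * A i j) = (\<Sum>i<m. (u i - v i) * A i j)"
    by (simp add: left_diff_distrib sum_subtractf)
  also have "j < b \<Longrightarrow> \<dots> \<in> parameter_ideal"
    using assms by (intro variable_ideal_sum variable_ideal_mult') (auto simp: param_congruent_def)
  finally show "matrix_map m b A u j - matrix_map m b A v j \<in> parameter_ideal"
    by (simp add: matrix_map_def)
qed

text \<open>An invertible scalar matrix is an isomorphism of free modules that respects degrees and
  congruence modulo the parameters, so it preserves the colon ideals.\<close>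

lemma linear_quotients_matrix_map:
  assumes lq: "linear_quotients d k s"
    and supp: "\<And>j i. j < k \<Longrightarrow> i \<ge> m \<Longrightarrow> s j i = 0"
    and A: "\<And>i j. i < m \<Longrightarrow> j < b \<Longrightarrow> A i j \<in> homogeneous_polys n 0"
    and B: "\<And>i j. i < m \<Longrightarrow> j < b \<Longrightarrow> B j i \<in> homogeneous_polys n 0"
    and AB: "\<And>i i'. i < m \<Longrightarrow> i' < m \<Longrightarrow> (\<Sum>j<b. A i j * B j i') = (if i = i' then 1 else 0)"
  shows "linear_quotients d k (\<lambda>j. matrix_map m b A (s j))"
  unfolding linear_quotients_def
proof (intro allI impI conjI)
  fix j l assume j: "j < k"
  have "s j i \<in> homogeneous_polys n d" for i using lq j by (simp add: linear_quotients_def)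
  then have "l < b \<Longrightarrow> i < m \<Longrightarrow> s j i * A i l \<in> homogeneous_polys n d" for i
    using homogeneous_polys_mult[of "s j i" n d "A i l" 0] A by simp
  then show "matrix_map m b A (s j) l \<in> homogeneous_polys n d"
    by (auto simp: matrix_map_def intro!: homogeneous_polys_sum) (simp add: homogeneous_polys_def)
next
  fix j assume j: "j < k"
  obtain V where V: "colon_generated_by V s j" using lq j by (auto simp: linear_quotients_def)
  let ?\<phi> = "matrix_map m b A" and ?\<psi> = "matrix_map b m B"
  have "(\<exists>t\<in>poly_span n {..<j} (\<lambda>j. ?\<phi> (s j)). param_congruent (\<lambda>l. r * ?\<phi> (s j) l) t) \<longleftrightarrow>
        (\<exists>t\<in>poly_span n {..<j} s. param_congruent (\<lambda>l. r * s j l) t)" (is "?L \<longleftrightarrow> ?R") for r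
  proof
    assume ?L
    then obtain t where t: "t \<in> poly_span n {..<j} (\<lambda>j. ?\<phi> (s j))" "param_congruent (\<lambda>l. r * ?\<phi> (s j) l) t" by blast
    obtain c where c: "\<And>i. i < j \<Longrightarrow> c i \<in> poly_ring n" "\<And>l. t l = (\<Sum>i<j. c i * ?\<phi> (s i) l)"
      using t(1) by (rule poly_spanE) blast
    define u where "u l = (\<Sum>i<j. c i * s i l)" for l
    have t_u: "t = ?\<phi> u"
      unfolding u_def matrix_map_sum using c(2) by blast
    have inv: "?\<psi> (?\<phi> x) = x" if "\<And>i. i \<ge> m \<Longrightarrow> x i = 0" for x
      by (rule matrix_map_inverse) (use AB that in auto)
    have "param_congruent (?\<phi> (\<lambda>l. r * s j l)) (?\<phi> u)"
      using t(2) by (simp add: t_u matrix_map_mult)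
    then have "param_congruent (?\<psi> (?\<phi> (\<lambda>l. r * s j l))) (?\<psi> (?\<phi> u))"
      by (rule param_congruent_matrix_map) (rule homogeneous_polys_poly_ring[OF B])
    moreover have "?\<psi> (?\<phi> (\<lambda>l. r * s j l)) = (\<lambda>l. r * s j l)"
      using supp j by (intro inv) simp
    moreover have "?\<psi> (?\<phi> u) = u"
      using supp j by (intro inv) (simp add: u_def)
    ultimately have "param_congruent (\<lambda>l. r * s j l) u" by simp
    moreover have "u \<in> poly_span n {..<j} s"
      using c(1) by (intro poly_spanI[of _ c]) (auto simp: u_def)
    ultimately show ?R by blast
  next
    assume ?R
    then obtain t where t: "t \<in> poly_span n {..<j} s" "param_congruent (\<lambda>l. r * s j l) t" by blast
    obtain c where c: "\<And>i. i < j \<Longrightarrow> c i \<in> poly_ring n" "\<And>l. t l = (\<Sum>i<j. c i * s i l)"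
      using t(1) by (rule poly_spanE) blast
    have "t = (\<lambda>l. \<Sum>i<j. c i * s i l)" using c(2) by blast
    then have "?\<phi> t \<in> poly_span n {..<j} (\<lambda>j. ?\<phi> (s j))"
      using c(1) by (intro poly_spanI[of _ c]) (simp_all add: matrix_map_sum)
    moreover have "param_congruent (?\<phi> (\<lambda>l. r * s j l)) (?\<phi> t)"
      using t(2) A by (intro param_congruent_matrix_map) (auto intro: homogeneous_polys_poly_ring)
    ultimately show ?L by (auto simp: matrix_map_mult)
  qed
  then show "\<exists>V. colon_generated_by V (\<lambda>j. ?\<phi> (s j)) j"
    using V unfolding colon_generated_by_def by auto
qed

text \<open>Passing from the special generators to arbitrary minimal ones is what allows a statement about
  every minimal resolution, not only about the one that is constructed.\<close>

lemma linear_module_minimal_syzygies: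
  assumes M: "linear_module d M"
    and g: "minimal_hom_generators n e M b e' g"
    and supp: "\<And>v l. v \<in> M \<Longrightarrow> v l \<noteq> 0 \<Longrightarrow> e l = E"
  shows "j < b \<Longrightarrow> e' j = E + d"
    and "linear_module 1 (syzygy_module n b g)"
proof -
  obtain m h where h: "linear_quotients d m h" "M = poly_span n {..<m} h"
    and reg: "parameters_regular M"
    using M unfolding linear_module_def by blast
  have supp': "\<forall>v\<in>M. \<forall>l. v l \<noteq> 0 \<longrightarrow> e l = E" using supp by blast
  obtain A B where e': "\<And>j. j < b \<Longrightarrow> e' j = E + d"
    and A: "\<And>i j. i < m \<Longrightarrow> j < b \<Longrightarrow> A i j \<in> homogeneous_polys n 0"
    and B: "\<And>i j. i < m \<Longrightarrow> j < b \<Longrightarrow> B j i \<in> homogeneous_polys n 0"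
    and hA: "\<And>i l. i < m \<Longrightarrow> h i l = (\<Sum>j<b. A i j * g j l)"
    and gB: "\<And>j l. j < b \<Longrightarrow> g j l = (\<Sum>i<m. B j i * h i l)"
    and AB: "\<And>i i'. i < m \<Longrightarrow> i' < m \<Longrightarrow> (\<Sum>j<b. A i j * B j i') = (if i = i' then 1 else 0)"
    and BA: "\<And>j j'. j < b \<Longrightarrow> j' < b \<Longrightarrow> (\<Sum>i<m. B j i * A i j') = (if j = j' then 1 else 0)"
    by (rule change_of_minimal_generators[OF h g supp']) (rule that, assumption+)
  show "j < b \<Longrightarrow> e' j = E + d" by (rule e')
  have A_R: "A i j \<in> poly_ring n" and B_R: "B j i \<in> poly_ring n" if "i < m" "j < b" for i j
    using A[OF that] B[OF that] by (auto intro: homogeneous_polys_poly_ring)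
  let ?\<phi> = "matrix_map m b A" and ?\<psi> = "matrix_map b m B"
  have "linear_module 1 (syzygy_module n m h)"
    using linear_module_syzygies[OF h(1)] reg h(2) by simp
  then obtain k s where s: "linear_quotients 1 k s" "syzygy_module n m h = poly_span n {..<k} s"
    unfolding linear_module_def by blast
  have s_syz: "s j \<in> syzygy_module n m h" if "j < k" for j
    unfolding s(2) using that by (intro generator_in_poly_span) auto
  have "linear_quotients 1 k (\<lambda>j. ?\<phi> (s j))"
    by (rule linear_quotients_matrix_map[OF s(1) _ A B AB]) (auto intro: syzygy_moduleD(2)[OF s_syz])
  moreover have "syzygy_module n b g = poly_span n {..<k} (\<lambda>j. ?\<phi> (s j))"
  proof
    show "poly_span n {..<k} (\<lambda>j. ?\<phi> (s j)) \<subseteq> syzygy_module n b g"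
      by (intro poly_span_subset poly_submodule_syzygy_module matrix_map_syzygy[OF s_syz A_R hA]) auto
    show "syzygy_module n b g \<subseteq> poly_span n {..<k} (\<lambda>j. ?\<phi> (s j))"
    proof
      fix c assume c: "c \<in> syzygy_module n b g"
      have "?\<psi> c \<in> poly_span n {..<k} s"
        unfolding s(2)[symmetric] by (rule matrix_map_syzygy[OF c B_R gB])
      then obtain a where a: "\<And>i. i < k \<Longrightarrow> a i \<in> poly_ring n" "\<And>l. ?\<psi> c l = (\<Sum>i<k. a i * s i l)"
        by (rule poly_spanE) blast
      have "?\<psi> c = (\<lambda>l. \<Sum>i<k. a i * s i l)" using a(2) by blast
      then have "?\<phi> (?\<psi> c) \<in> poly_span n {..<k} (\<lambda>j. ?\<phi> (s j))"
        using a(1) by (intro poly_spanI[of _ a]) (simp_all add: matrix_map_sum)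
      moreover have "?\<phi> (?\<psi> c) = c"
        by (rule matrix_map_inverse[OF BA]) (auto intro: syzygy_moduleD(2)[OF c])
      ultimately show "c \<in> poly_span n {..<k} (\<lambda>j. ?\<phi> (s j))" by simp
    qed
  qed
  moreover have "parameters_regular (syzygy_module n b g)"
  proof (rule parameters_regular_syzygy_module)
    have M_g: "poly_span n {..<b} g = M" using g by (simp add: minimal_hom_generators_def)
    then show "parameters_regular (poly_span n {..<b} g)" using reg by simp
    have "h i l \<in> poly_ring n" if "i < m" for i l
      using h(1) that by (intro homogeneous_polys_poly_ring[of _ n d]) (simp add: linear_quotients_def)
    then show "g j l \<in> poly_ring n" if "j < b" for j l
      unfolding gB[OF that] using that B_R by (intro poly_ring_sum poly_ring_mult) auto
  qed
  ultimately show "linear_module 1 (syzygy_module n b g)"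
    unfolding linear_module_def by blast
qed

text \<open>By induction every minimal resolution has all its generators of step \<open>i\<close> in degree \<open>d + i\<close>, so
  the maximum in the regularity is attained at each nonzero step and equals \<open>d\<close>. A resolution
  exists because each syzygy module is a linear module again and therefore has minimal generators.\<close>

lemma linear_ideal_regularity:
  fixes I :: "'k::field mpol set"
  assumes lin: "linear_module d (ideal_module I)" and "n \<ge> 2" and nonzero: "ideal_module I \<noteq> {\<lambda>_. 0}"
  shows "regularity n I = int d"
proof -
  have reg_eq: "resolution_regularity n \<beta> e = int d" if res: "minimal_graded_resolution n I \<beta> e g" for \<beta> e g
  proof -
    have g0: "minimal_hom_generators n (\<lambda>_. 0) (ideal_module I) (\<beta> 0) (e 0) (g 0)"
      and gS: "minimal_hom_generators n (e i) (syzygy_module n (\<beta> i) (g i)) (\<beta> (Suc i)) (e (Suc i)) (g (Suc i))" for i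
      using res by (auto simp: minimal_graded_resolution_def)
    have *: "(\<forall>j<\<beta> i. e i j = d + i) \<and> linear_module 1 (syzygy_module n (\<beta> i) (g i))" for i
    proof (induction i)
      case 0
      show ?case using linear_module_minimal_syzygies[OF lin g0, of 0] by simp
    next
      case (Suc i)
      have "e i l = d + i" if "v \<in> syzygy_module n (\<beta> i) (g i)" "v l \<noteq> 0" for v l
        using Suc syzygy_moduleD(2)[OF that(1)] that(2) by (metis not_less)
      then show ?case
        using linear_module_minimal_syzygies[OF conjunct2[OF Suc] gS, of "d + i"] by simp
    qed
    have "\<beta> 0 > 0"
    proof (rule ccontr)
      assume "\<not> \<beta> 0 > 0"
      then have "poly_span n {} (g 0) = ideal_module I" using g0 by (simp add: minimal_hom_generators_def)
      then show False using nonzero by (auto simp: poly_span_def)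
    qed
    have "int (Max (e i ` {..<\<beta> i})) - int i = int d" if "\<beta> i > 0" for i
    proof -
      have "e i ` {..<\<beta> i} = (\<lambda>_. d + i) ` {..<\<beta> i}" using * by (intro image_cong) auto
      also have "\<dots> = {d + i}" using that by auto
      finally show ?thesis by simp
    qed
    then have "{int (Max (e i ` {..<\<beta> i})) - int i | i. i + 2 \<le> n \<and> \<beta> i > 0} =
        {int d | i. i + 2 \<le> n \<and> \<beta> i > 0}" by metis
    also have "\<dots> = {int d}" using \<open>\<beta> 0 > 0\<close> \<open>n \<ge> 2\<close> by (auto intro!: exI[of _ "0::nat"])
    finally have "{int (Max (e i ` {..<\<beta> i})) - int i | i. i + 2 \<le> n \<and> \<beta> i > 0} = {int d}" .
    then show ?thesis by (simp add: resolution_regularity_def)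
  qed
  have gens: "\<exists>b g. minimal_hom_generators n (\<lambda>_. E) M b (\<lambda>_. E + x) g" if "linear_module x M"
    for x E and M :: "(nat \<Rightarrow> 'k mpol) set"
    using that linear_quotients_minimal_generators[of x _ _ "\<lambda>_. E" E] unfolding linear_module_def by blast
  have next_syz: "linear_module 1 (syzygy_module n b g)"
    if "linear_module x M" "minimal_hom_generators n (\<lambda>_. E) M b e' g"
    for x E M b e' and g :: "nat \<Rightarrow> nat \<Rightarrow> 'k mpol"
    using linear_module_minimal_syzygies(2)[OF that] by blast
  define P where "P i x \<longleftrightarrow> linear_module 1 (syzygy_module n (fst x) (snd x)) \<and>
      (i = 0 \<longrightarrow> minimal_hom_generators n (\<lambda>_. 0) (ideal_module I) (fst x) (\<lambda>_. d) (snd x))"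
    for i :: nat and x :: "nat \<times> (nat \<Rightarrow> nat \<Rightarrow> 'k mpol)"
  define Q where "Q i x y \<longleftrightarrow> minimal_hom_generators n (\<lambda>_. d + i) (syzygy_module n (fst x) (snd x))
      (fst y) (\<lambda>_. d + Suc i) (snd y)"
    for i :: nat and x y :: "nat \<times> (nat \<Rightarrow> nat \<Rightarrow> 'k mpol)"
  \<comment> \<open>the resolution is built step by step, from generators to generators of their syzygies\<close>
  have "\<exists>f. \<forall>i. P i (f i) \<and> Q i (f i) (f (Suc i))"
  proof (rule dependent_nat_choice)
    obtain b g where "minimal_hom_generators n (\<lambda>_. 0) (ideal_module I) b (\<lambda>_. d) g"
      using gens[OF lin, of 0] by auto
    then have "P 0 (b, g)" using next_syz[OF lin] by (auto simp: P_def)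
    then show "\<exists>x. P 0 x" by blast
  next
    fix x i assume "P i x"
    then have lin': "linear_module 1 (syzygy_module n (fst x) (snd x))" by (simp add: P_def)
    obtain b g where bg: "minimal_hom_generators n (\<lambda>_. d + i) (syzygy_module n (fst x) (snd x)) b (\<lambda>_. d + i + 1) g"
      using gens[OF lin'] by blast
    then have "P (Suc i) (b, g) \<and> Q i x (b, g)"
      using next_syz[OF lin' bg] by (simp add: P_def Q_def)
    then show "\<exists>y. P (Suc i) y \<and> Q i x y" by blast
  qed
  then obtain f where f: "\<And>i. P i (f i)" "\<And>i. Q i (f i) (f (Suc i))" by blast
  have "minimal_graded_resolution n I (\<lambda>i. fst (f i)) (\<lambda>i _. d + i) (\<lambda>i. snd (f i))"
    using f(1)[of 0] f(2) by (auto simp: minimal_graded_resolution_def P_def Q_def)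
  then have ex: "\<exists>\<beta> e g. minimal_graded_resolution n I \<beta> e g \<and> int d = resolution_regularity n \<beta> e"
    using reg_eq[symmetric] by meson
  then show ?thesis
    unfolding regularity_def by (rule the_equality) (use reg_eq in meson)
qed

end

section \<open>The ideal of the rational normal curve\<close>

text \<open>As \<open>x\<^sub>i\<close> is mapped to \<open>t\<close> to the power \<open>a + (i - 1) d\<close>, a monomial is mapped to \<open>t\<close> to the power
  \<open>D a + w d\<close>, where \<open>D\<close> is its degree and \<open>w\<close> its weight.\<close>

definition weight :: "(nat \<Rightarrow>\<^sub>0 nat) \<Rightarrow> nat" where
  "weight m = (\<Sum>i\<in>Poly_Mapping.keys m. Poly_Mapping.lookup m i * (i - 1))"

lemma weight_eq_sum:
  "finite A \<Longrightarrow> Poly_Mapping.keys m \<subseteq> A \<Longrightarrow> weight m = (\<Sum>i\<in>A. Poly_Mapping.lookup m i * (i - 1))"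
  unfolding weight_def by (rule sum.mono_neutral_left) (auto simp: in_keys_iff)

lemma weight_add: "weight (a + b) = weight a + weight b"
proof -
  let ?A = "Poly_Mapping.keys a \<union> Poly_Mapping.keys b"
  have "weight (a + b) = (\<Sum>i\<in>?A. Poly_Mapping.lookup (a + b) i * (i - 1))"
    by (rule weight_eq_sum) (auto simp: keys_add_nat)
  also have "\<dots> = weight a + weight b"
    by (simp add: lookup_add distrib_right sum.distrib weight_eq_sum[of ?A])
  finally show ?thesis .
qed

lemma weight_0 [simp]: "weight 0 = 0"
  and weight_single [simp]: "weight (Poly_Mapping.single v e) = e * (v - 1)"
  by (auto simp: weight_def)

lemma weight_le:
  assumes "Poly_Mapping.keys m \<subseteq> {1..Suc k}"
  shows "weight m \<le> k * mono_deg m"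
  unfolding weight_def mono_deg_def sum_distrib_left
proof (rule sum_mono)
  fix i assume "i \<in> Poly_Mapping.keys m"
  then have "i - 1 \<le> k" using assms by force
  then show "Poly_Mapping.lookup m i * (i - 1) \<le> k * Poly_Mapping.lookup m i"
    by (simp add: mult.commute)
qed

lemma monomial_of_degree_weight:
  assumes "w \<le> k * D"
  shows "\<exists>m. Poly_Mapping.keys m \<subseteq> {1..Suc k} \<and> mono_deg m = D \<and> weight m = w"
  using assms
proof (induction D arbitrary: w)
  case 0
  then show ?case by (intro exI[of _ 0]) auto
next
  case (Suc D)
  show ?case
  proof (cases "w \<ge> k")
    case True
    have "w - k \<le> k * D" using Suc.prems by simp
    then obtain m where "Poly_Mapping.keys m \<subseteq> {1..Suc k}" "mono_deg m = D" "weight m = w - k"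
      using Suc.IH by blast
    with True show ?thesis
      by (intro exI[of _ "Poly_Mapping.single (Suc k) 1 + m"])
        (auto simp: keys_add_nat mono_deg_add weight_add)
  next
    case False
    then show ?thesis
      by (intro exI[of _ "Poly_Mapping.single (Suc w) 1 + Poly_Mapping.single 1 D"])
        (auto simp: keys_add_nat mono_deg_add weight_add)
  qed
qed

text \<open>The coefficient of the image of \<open>p\<close> at the exponent \<open>D a + w d\<close>.\<close>

definition class_sum :: "'k::field mpol \<Rightarrow> nat \<Rightarrow> nat \<Rightarrow> 'k" where
  "class_sum p D w = (\<Sum>m\<in>Poly_Mapping.keys p.
     if mono_deg m = D \<and> weight m = w then Poly_Mapping.lookup p m else 0)"

lemma class_sum_eq_sum:
  "finite A \<Longrightarrow> Poly_Mapping.keys p \<subseteq> A \<Longrightarrow>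
   class_sum p D w = (\<Sum>m\<in>A. if mono_deg m = D \<and> weight m = w then Poly_Mapping.lookup p m else 0)"
  unfolding class_sum_def by (rule sum.mono_neutral_left) (auto simp: in_keys_iff)

lemma class_sum_0 [simp]: "class_sum 0 D w = 0"
  by (simp add: class_sum_def)

lemma class_sum_add: "class_sum (p + q) D w = class_sum p D w + class_sum q D w"
proof -
  let ?A = "Poly_Mapping.keys p \<union> Poly_Mapping.keys q"
  have "class_sum (p + q) D w =
      (\<Sum>m\<in>?A. if mono_deg m = D \<and> weight m = w then Poly_Mapping.lookup (p + q) m else 0)"
    by (rule class_sum_eq_sum) (auto simp: keys_add)
  also have "\<dots> = (\<Sum>m\<in>?A. (if mono_deg m = D \<and> weight m = w then Poly_Mapping.lookup p m else 0) +
      (if mono_deg m = D \<and> weight m = w then Poly_Mapping.lookup q m else 0))"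
    by (intro sum.cong) (auto simp: lookup_add)
  also have "\<dots> = class_sum p D w + class_sum q D w"
    by (simp add: sum.distrib class_sum_eq_sum[of ?A])
  finally show ?thesis .
qed

lemma class_sum_diff: "class_sum (p - q) D w = class_sum p D w - class_sum q D w"
  using class_sum_add[of "p - q" q D w] by (simp add: algebra_simps)

lemma class_sum_sum: "class_sum (\<Sum>i\<in>A. f i) D w = (\<Sum>i\<in>A. class_sum (f i) D w)"
  by (induction A rule: infinite_finite_induct) (auto simp: class_sum_add)

lemma class_sum_single:
  "class_sum (Poly_Mapping.single m x) D w = (if mono_deg m = D \<and> weight m = w then x else 0)"
  by (simp add: class_sum_def)

lemma class_sum_single_mult:
  "class_sum (Poly_Mapping.single t c * p) D w =
     (if mono_deg t \<le> D \<and> weight t \<le> w then c * class_sum p (D - mono_deg t) (w - weight t) else 0)"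
proof -
  have "Poly_Mapping.single t c * p =
      (\<Sum>m\<in>Poly_Mapping.keys p. Poly_Mapping.single (t + m) (c * Poly_Mapping.lookup p m))"
    by (subst poly_mapping_sum_singles[of p], unfold sum_distrib_left, intro sum.cong refl)
       (simp add: mult_single)
  then have "class_sum (Poly_Mapping.single t c * p) D w = (\<Sum>m\<in>Poly_Mapping.keys p.
      if mono_deg (t + m) = D \<and> weight (t + m) = w then c * Poly_Mapping.lookup p m else 0)"
    by (simp add: class_sum_sum class_sum_single)
  also have "\<dots> = (if mono_deg t \<le> D \<and> weight t \<le> w
      then c * class_sum p (D - mono_deg t) (w - weight t) else 0)"
    unfolding class_sum_def sum_distrib_left
    by (auto simp: mono_deg_add weight_add intro!: sum.cong sum.neutral)
  finally show ?thesis .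
qed

lemma class_sum_var_mult:
  "class_sum (var v * p) D w = (if 1 \<le> D \<and> v - 1 \<le> w then class_sum p (D - 1) (w - (v - 1)) else 0)"
  by (simp add: var_def class_sum_single_mult)

text \<open>The homogeneous ideal of the rational normal curve of degree \<open>k\<close>.\<close>

definition curve_ideal :: "nat \<Rightarrow> 'k::field mpol set" where
  "curve_ideal k = {p \<in> poly_ring (Suc k). \<forall>D w. class_sum p D w = 0}"

lemma curve_idealD:
  "p \<in> curve_ideal k \<Longrightarrow> p \<in> poly_ring (Suc k)" "p \<in> curve_ideal k \<Longrightarrow> class_sum p D w = 0"
  by (auto simp: curve_ideal_def)

lemma curve_ideal_add: "p \<in> curve_ideal k \<Longrightarrow> q \<in> curve_ideal k \<Longrightarrow> p + q \<in> curve_ideal k"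
  and curve_ideal_diff: "p \<in> curve_ideal k \<Longrightarrow> q \<in> curve_ideal k \<Longrightarrow> p - q \<in> curve_ideal k"
  by (auto simp: curve_ideal_def class_sum_add class_sum_diff intro: poly_ring_add poly_ring_diff)

lemma curve_ideal_mult:
  assumes "r \<in> poly_ring (Suc k)" "p \<in> curve_ideal k"
  shows "r * p \<in> curve_ideal k"
proof -
  have "r * p = (\<Sum>t\<in>Poly_Mapping.keys r. Poly_Mapping.single t (Poly_Mapping.lookup r t) * p)"
    by (subst (1) poly_mapping_sum_singles[of r]) (rule sum_distrib_right)
  then have "class_sum (r * p) D w = 0" for D w
    using assms(2)
    by (auto simp: class_sum_sum class_sum_single_mult curve_ideal_def intro!: sum.neutral)
  with assms show ?thesis by (auto simp: curve_ideal_def intro: poly_ring_mult)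
qed

lemma curve_ideal_0 [simp]: "0 \<in> curve_ideal k"
  by (simp add: curve_ideal_def)

lemma poly_submodule_ideal_module: "poly_submodule (Suc k) (ideal_module (curve_ideal k))"
  unfolding poly_submodule_def ideal_module_def
  by (auto intro: curve_ideal_add curve_ideal_mult) (metis curve_idealD(1) gr0I poly_ring_0)

lemma curve_ideal_cancel:
  assumes "u \<in> poly_ring (Suc k)" "var (Suc k) * u \<in> curve_ideal k"
  shows "u \<in> curve_ideal k"
proof -
  have "class_sum u D w = class_sum (var (Suc k) * u) (Suc D) (w + k)" for D w
    by (simp add: class_sum_var_mult)
  with assms show ?thesis by (simp add: curve_ideal_def)
qed

lemma mono_deg_1E:
  assumes "mono_deg m = 1"
  obtains i where "m = Poly_Mapping.single i 1"
proof -
  obtain i where i: "i \<in> Poly_Mapping.keys m" "Poly_Mapping.lookup m i = 1"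
    "\<forall>j\<in>Poly_Mapping.keys m. i \<noteq> j \<longrightarrow> Poly_Mapping.lookup m j = 0"
    using assms sum_eq_1_iff[of "Poly_Mapping.keys m" "Poly_Mapping.lookup m"]
    unfolding mono_deg_def by auto
  then have "m = Poly_Mapping.single i 1"
    by (intro poly_mapping_eqI) (auto simp: lookup_single when_def in_keys_iff)
  then show ?thesis by (rule that)
qed

text \<open>A monomial of degree at most one is determined by its degree and weight, so its coefficient
  is a class sum.\<close>

lemma curve_ideal_degree_ge_2:
  assumes "p \<in> curve_ideal k" "m \<in> Poly_Mapping.keys p"
  shows "mono_deg m \<ge> 2"
proof (rule ccontr)
  assume small: "\<not> mono_deg m \<ge> 2"
  have keys: "Poly_Mapping.keys m' \<subseteq> {1..Suc k}" if "m' \<in> Poly_Mapping.keys p" for m'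
    using curve_idealD(1)[OF assms(1)] that by (simp add: poly_ring_def)
  have unique: "m' = m" if "m' \<in> Poly_Mapping.keys p" "mono_deg m' = mono_deg m" "weight m' = weight m" for m'
  proof (cases "mono_deg m = 0")
    case True
    then show ?thesis using that mono_deg_eq_0_iff by metis
  next
    case False
    then have deg: "mono_deg m = 1" "mono_deg m' = 1" using small that(2) by auto
    obtain i where i: "m = Poly_Mapping.single i 1" using deg(1) by (rule mono_deg_1E)
    obtain i' where i': "m' = Poly_Mapping.single i' 1" using deg(2) by (rule mono_deg_1E)
    have "i \<ge> 1" "i' \<ge> 1" using keys[OF assms(2)] keys[OF that(1)] by (auto simp: i i')
    then have "i = i'" using that(3) by (simp add: i i')
    then show ?thesis by (simp add: i i')
  qed
  have "class_sum p (mono_deg m) (weight m) =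
      (\<Sum>m'\<in>Poly_Mapping.keys p. if m' = m then Poly_Mapping.lookup p m' else 0)"
    unfolding class_sum_def using unique by (intro sum.cong) auto
  also have "\<dots> = Poly_Mapping.lookup p m" using assms(2) by simp
  finally show False using assms by (simp add: curve_ideal_def in_keys_iff)
qed

locale rational_normal_curve =
  fixes k :: nat
  assumes k_ge_2: "k \<ge> 2"
begin

sublocale two_parameters "Suc k" "Suc 0" "Suc k"
  by unfold_locales (use k_ge_2 in auto)

text \<open>For any \<open>f\<close>, subtracting the last variable times \<open>f\<close> from \<open>u\<close> gives a new splitting. The
  resulting \<open>s\<close> lies in the ideal iff the class sum of \<open>f\<close> at \<open>(D, w)\<close> is that of \<open>u\<close> at \<open>(D + 1, w + k)\<close> and the class sums of
  \<open>u\<close> at weights below \<open>k\<close> vanish. The latter holds because the first variable has weight \<open>0\<close>, whereas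
  multiples of the last one, of weight \<open>k\<close>, do not contribute to those classes. A suitable \<open>f\<close> exists because every pair of a
  degree \<open>D\<close> and a weight \<open>w \<le> k D\<close> is realised by a monomial.\<close>

lemma curve_ideal_split:
  assumes u: "u \<in> poly_ring (Suc k)" and x: "x \<in> poly_ring (Suc k)"
    and v: "var (Suc 0) * u + var (Suc k) * x \<in> curve_ideal k"
  obtains s t where "s \<in> curve_ideal k" "t \<in> curve_ideal k"
    "var (Suc 0) * u + var (Suc k) * x = var (Suc 0) * s + var (Suc k) * t"
proof -
  have keys_u: "Poly_Mapping.keys m \<subseteq> {1..Suc k}" if "m \<in> Poly_Mapping.keys u" for m
    using u that by (simp add: poly_ring_def)
  define r where "r D w = (SOME m. Poly_Mapping.keys m \<subseteq> {1..Suc k} \<and> mono_deg m = D \<and> weight m = w)" for D w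
  have r: "Poly_Mapping.keys (r D w) \<subseteq> {1..Suc k} \<and> mono_deg (r D w) = D \<and> weight (r D w) = w"
    if "w \<le> k * D" for D w
    unfolding r_def by (rule someI_ex) (rule monomial_of_degree_weight[OF that])
  define K where "K = {m\<in>Poly_Mapping.keys u. k \<le> weight m}"
  \<comment> \<open>divide \<open>u\<close> by the last variable on the level of classes of monomials\<close>
  define f where "f = (\<Sum>m\<in>K. Poly_Mapping.single (r (mono_deg m - 1) (weight m - k)) (Poly_Mapping.lookup u m))"
  have K: "weight m \<ge> k" "mono_deg m \<ge> 1" "weight m - k \<le> k * (mono_deg m - 1)" if "m \<in> K" for m
  proof -
    have le: "weight m \<le> k * mono_deg m" using that keys_u by (intro weight_le) (auto simp: K_def)
    show w: "weight m \<ge> k" using that by (simp add: K_def)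
    then show "mono_deg m \<ge> 1" using le k_ge_2 by (cases "mono_deg m") auto
    then show "weight m - k \<le> k * (mono_deg m - 1)" using le by (simp add: diff_mult_distrib2)
  qed
  have f_R: "f \<in> poly_ring (Suc k)"
    unfolding f_def poly_ring_eq_monomial_span
    using r K by (intro monomial_span_sum single_in_monomial_span) auto
  have f_sum: "class_sum f D w = class_sum u (Suc D) (w + k)" for D w
  proof -
    have "class_sum f D w = (\<Sum>m\<in>K. if mono_deg m = Suc D \<and> weight m = w + k then Poly_Mapping.lookup u m else 0)"
      unfolding f_def class_sum_sum class_sum_single
    proof (intro sum.cong refl)
      fix m assume m: "m \<in> K"
      have "mono_deg m - 1 = D \<longleftrightarrow> mono_deg m = Suc D" "weight m - k = w \<longleftrightarrow> weight m = w + k"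
        using K(1,2)[OF m] by auto
      then show "(if mono_deg (r (mono_deg m - 1) (weight m - k)) = D \<and> weight (r (mono_deg m - 1) (weight m - k)) = w
          then Poly_Mapping.lookup u m else 0) =
        (if mono_deg m = Suc D \<and> weight m = w + k then Poly_Mapping.lookup u m else 0)"
        using r[OF K(3)[OF m]] by simp
    qed
    also have "\<dots> = class_sum u (Suc D) (w + k)"
      unfolding class_sum_def by (rule sum.mono_neutral_left) (auto simp: K_def)
    finally show ?thesis .
  qed
  define s where "s = u - var (Suc k) * f"
  define t where "t = x + var (Suc 0) * f"
  have eq: "var (Suc 0) * u + var (Suc k) * x = var (Suc 0) * s + var (Suc k) * t"
    by (simp add: s_def t_def algebra_simps)
  have s_R: "s \<in> poly_ring (Suc k)" "t \<in> poly_ring (Suc k)"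
    unfolding s_def t_def by (intro poly_ring_diff poly_ring_add poly_ring_mult u x f_R var_in_poly_ring p_var q_var)+
  have "class_sum s D w = 0" for D w
  proof (cases "k \<le> w")
    case True
    show ?thesis
    proof (cases D)
      case 0
      have "weight m < k" if "m \<in> Poly_Mapping.keys u" "mono_deg m = 0" for m
        using that k_ge_2 by (simp add: mono_deg_eq_0_iff)
      then have "class_sum u 0 w = 0"
        unfolding class_sum_def using True by (intro sum.neutral) force
      then show ?thesis using 0 by (simp add: s_def class_sum_diff class_sum_var_mult)
    next
      case (Suc D')
      then show ?thesis using True by (simp add: s_def class_sum_diff class_sum_var_mult f_sum)
    qed
  next
    case False
    have "class_sum u D w = class_sum (var (Suc 0) * u + var (Suc k) * x) (Suc D) w"
      using False by (simp add: class_sum_add class_sum_var_mult)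
    also have "\<dots> = 0" using v by (simp add: curve_ideal_def)
    finally show ?thesis using False by (simp add: s_def class_sum_diff class_sum_var_mult)
  qed
  with s_R have s: "s \<in> curve_ideal k" by (simp add: curve_ideal_def)
  have "var (Suc k) * t = (var (Suc 0) * u + var (Suc k) * x) - var (Suc 0) * s"
    using eq by simp
  also have "\<dots> \<in> curve_ideal k"
    by (intro curve_ideal_diff v curve_ideal_mult s var_in_poly_ring p_var)
  finally have "t \<in> curve_ideal k" using s_R(2) curve_ideal_cancel by blast
  with s eq show ?thesis using that by blast
qed

lemma parameters_regular_curve_ideal:
  "parameters_regular (ideal_module (curve_ideal k :: 'k::field mpol set))"
  unfolding parameters_regular_def
proof (intro conjI allI impI ballI)
  fix u :: "nat \<Rightarrow> 'k mpol"
  assume "(\<forall>l. u l \<in> poly_ring (Suc k)) \<and> (\<lambda>l. var (Suc k) * u l) \<in> ideal_module (curve_ideal k)"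
  then show "u \<in> ideal_module (curve_ideal k)"
    using curve_ideal_cancel by (auto simp: ideal_module_def var_nonzero)
next
  fix v :: "nat \<Rightarrow> 'k mpol"
  assume v: "v \<in> ideal_module (curve_ideal k)" and "\<forall>l. v l \<in> parameter_ideal"
  then obtain u x where ux: "u \<in> poly_ring (Suc k)" "x \<in> poly_ring (Suc k)"
    "v 0 = var (Suc 0) * u + var (Suc k) * x"
    using variable_ideal_two_vars by blast
  moreover have "v 0 \<in> curve_ideal k" using v by (simp add: ideal_module_def)
  ultimately obtain s t where st: "s \<in> curve_ideal k" "t \<in> curve_ideal k"
    "v 0 = var (Suc 0) * s + var (Suc k) * t"
    using curve_ideal_split[of u x] by metis
  then show "\<exists>s\<in>ideal_module (curve_ideal k). \<exists>t\<in>ideal_module (curve_ideal k).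
      \<forall>l. v l = var (Suc 0) * s l + var (Suc k) * t l"
    using v by (intro bexI[of _ "\<lambda>l. if l = 0 then s else 0"] bexI[of _ "\<lambda>l. if l = 0 then t else 0"])
      (auto simp: ideal_module_def)
qed

text \<open>Modulo the first and the last variable, each product of two inner variables lies in the ideal:
  shifting the indices apart until one of them reaches the boundary preserves degree and weight.\<close>

lemma curve_binomial:
  assumes "2 \<le> i" "i \<le> j" "j \<le> k"
  obtains g :: "'k::field mpol" where "g \<in> curve_ideal k" "g \<in> homogeneous_polys (Suc k) 2"
    "var i * var j - g \<in> parameter_ideal"
proof -
  define u where "u = (if i + j \<le> k + 2 then Suc 0 else Suc k)"
  define c where "c = (if i + j \<le> k + 2 then i + j - 1 else i + j - Suc k)"
  have uc: "u \<in> {Suc 0, Suc k}" "c \<in> {1..Suc k}" "u \<in> {1..Suc k}" "(i - 1) + (j - 1) = (u - 1) + (c - 1)"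
    using assms by (auto simp: u_def c_def)
  let ?g = "var i * var j - var u * var c :: 'k mpol"
  have R: "var i \<in> poly_ring (Suc k)" "var j \<in> poly_ring (Suc k)"
    using assms by (auto intro!: var_in_poly_ring)
  show ?thesis
  proof (rule that[of ?g])
    have "class_sum ?g D w = 0" for D w
      using uc(4) by (simp add: class_sum_diff var_def mult_single class_sum_single mono_deg_add weight_add)
    moreover have "?g \<in> poly_ring (Suc k)"
      by (intro poly_ring_diff poly_ring_mult R var_in_poly_ring uc)
    ultimately show "?g \<in> curve_ideal k" by (simp add: curve_ideal_def)
    have "var x * var y \<in> homogeneous_polys (Suc k) 2"
      if "x \<in> {1..Suc k}" "y \<in> {1..Suc k}" for x y
      using homogeneous_polys_mult[OF var_homogeneous[OF that(1)] var_homogeneous[OF that(2)]] 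
      by (simp add: numeral_2_eq_2)
    then show "?g \<in> homogeneous_polys (Suc k) 2"
      using uc assms by (intro homogeneous_polys_diff) auto
    show "var i * var j - ?g \<in> parameter_ideal"
      using uc by (auto intro!: variable_ideal_mult' var_in_variable_ideal var_in_poly_ring)
  qed
qed

definition divisible_by_pair :: "(nat \<times> nat) set \<Rightarrow> (nat \<Rightarrow>\<^sub>0 nat) \<Rightarrow> bool" where
  "divisible_by_pair E m \<longleftrightarrow>
     (\<exists>(i, j)\<in>E. \<exists>m'. m = Poly_Mapping.single i 1 + Poly_Mapping.single j 1 + m')"

text \<open>The monomial ideal generated by the parameters and the products \<open>x\<^sub>i x\<^sub>j\<close> with
  \<open>(i, j) \<in> E\<close>.\<close>

definition pair_ideal :: "(nat \<times> nat) set \<Rightarrow> 'k::field mpol set" where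
  "pair_ideal E = monomial_span (Suc k)
     (\<lambda>m. Poly_Mapping.keys m \<inter> {Suc 0, Suc k} \<noteq> {} \<or> divisible_by_pair E m)"

lemma divisible_by_pair_insert:
  "divisible_by_pair (insert (i, j) E) m \<longleftrightarrow>
     (\<exists>m'. m = Poly_Mapping.single i 1 + Poly_Mapping.single j 1 + m') \<or> divisible_by_pair E m"
  by (simp add: divisible_by_pair_def)

lemma divisible_by_pair_add:
  assumes "divisible_by_pair E m"
  shows "divisible_by_pair E (m + m')"
proof -
  obtain i j x where ij: "(i, j) \<in> E" and m: "m = Poly_Mapping.single i 1 + Poly_Mapping.single j 1 + x"
    using assms unfolding divisible_by_pair_def by blast
  have "m + m' = Poly_Mapping.single i 1 + Poly_Mapping.single j 1 + (x + m')"
    unfolding m by (simp add: add.assoc)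
  with ij show ?thesis unfolding divisible_by_pair_def by blast
qed

lemma divisible_by_pair_add': "divisible_by_pair E m \<Longrightarrow> divisible_by_pair E (m' + m)"
  using divisible_by_pair_add[of E m m'] by (simp add: add.commute)

lemma pair_ideal_add: "p \<in> pair_ideal E \<Longrightarrow> q \<in> pair_ideal E \<Longrightarrow> p + q \<in> pair_ideal E"
  and pair_ideal_diff: "p \<in> pair_ideal E \<Longrightarrow> q \<in> pair_ideal E \<Longrightarrow> p - q \<in> pair_ideal E"
  and pair_ideal_0: "0 \<in> pair_ideal E"
  unfolding pair_ideal_def by (auto intro: monomial_span_add monomial_span_diff)

lemma pair_ideal_mult:
  assumes "r \<in> poly_ring (Suc k)" "p \<in> pair_ideal E"
  shows "r * p \<in> pair_ideal E"
  using assms unfolding pair_ideal_def poly_ring_eq_monomial_span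
  by (rule monomial_span_mult) (auto simp: keys_add_nat intro: divisible_by_pair_add')

lemma parameter_ideal_pair_ideal: "p \<in> parameter_ideal \<Longrightarrow> p \<in> pair_ideal E"
  unfolding pair_ideal_def variable_ideal_def by (erule monomial_span_mono) auto

definition pair_part :: "(nat \<times> nat) set \<Rightarrow> (nat \<Rightarrow> 'k::field mpol) set" where
  "pair_part E = {v \<in> ideal_module (curve_ideal k). v 0 \<in> pair_ideal E}"

lemma poly_submodule_pair_part: "poly_submodule (Suc k) (pair_part E)"
  using poly_submodule_ideal_module[of k] unfolding poly_submodule_def pair_part_def
  by (auto intro!: pair_ideal_add pair_ideal_mult pair_ideal_0)

text \<open>Pairs are ordered by their larger entry first and then by the smaller one.\<close>

definition smaller_pairs :: "nat \<Rightarrow> nat \<Rightarrow> (nat \<times> nat) set" where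
  "smaller_pairs i j = {(i', j'). 2 \<le> i' \<and> i' \<le> j' \<and> (j' < j \<or> j' = j \<and> i' < i)}"

text \<open>The colon ideal of the smaller products by \<open>x\<^sub>i x\<^sub>j\<close> is generated by the parameters and the
  inner variables \<open>x\<^sub>l\<close> with \<open>l < j\<close>: the product \<open>x\<^sub>l x\<^sub>i x\<^sub>j\<close> is divisible by \<open>x\<^sub>l x\<^sub>i\<close>, or by
  \<open>x\<^sub>l x\<^sub>j\<close> if \<open>i = j\<close>, whereas multiplying \<open>x\<^sub>i x\<^sub>j\<close> by inner variables of index at least
  \<open>j\<close> creates no smaller pair.\<close>

lemma pair_colon:
  assumes ij: "2 \<le> i" "i \<le> j" "j \<le> k" and m: "Poly_Mapping.keys m \<subseteq> {1..Suc k}"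
  defines "t \<equiv> Poly_Mapping.single i 1 + Poly_Mapping.single j 1"
  shows "(Poly_Mapping.keys (t + m) \<inter> {Suc 0, Suc k} \<noteq> {} \<or> divisible_by_pair (smaller_pairs i j) (t + m)) \<longleftrightarrow>
     Poly_Mapping.keys m \<inter> ({Suc 0, Suc k} \<union> {2..<j}) \<noteq> {}"
proof
  assume L: "Poly_Mapping.keys (t + m) \<inter> {Suc 0, Suc k} \<noteq> {} \<or> divisible_by_pair (smaller_pairs i j) (t + m)"
  show "Poly_Mapping.keys m \<inter> ({Suc 0, Suc k} \<union> {2..<j}) \<noteq> {}"
  proof (cases "Poly_Mapping.keys (t + m) \<inter> {Suc 0, Suc k} \<noteq> {}")
    case True
    then show ?thesis using ij by (auto simp: t_def keys_add_nat)
  next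
    case False
    then obtain i' j' m' where *: "2 \<le> i'" "i' \<le> j'" "j' < j \<or> j' = j \<and> i' < i"
      "t + m = Poly_Mapping.single i' 1 + Poly_Mapping.single j' 1 + m'"
      using L by (auto simp: divisible_by_pair_def smaller_pairs_def)
    have **: "Poly_Mapping.lookup (t + m) l =
        Poly_Mapping.lookup (Poly_Mapping.single i' 1 + Poly_Mapping.single j' 1 + m') l" for l
      using *(4) by simp
    have "Poly_Mapping.lookup m i' > 0 \<or> Poly_Mapping.lookup m j' > 0 \<and> j' < j"
      using **[of i'] **[of j'] *(1-3) ij
      by (auto simp: t_def lookup_add lookup_single when_def split: if_splits)
    then show ?thesis using *(1-3) ij by (auto simp: in_keys_iff)
  qed
next
  assume "Poly_Mapping.keys m \<inter> ({Suc 0, Suc k} \<union> {2..<j}) \<noteq> {}"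
  then consider "Poly_Mapping.keys m \<inter> {Suc 0, Suc k} \<noteq> {}"
    | l where "l \<in> Poly_Mapping.keys m" "2 \<le> l" "l < j" by auto
  then show "Poly_Mapping.keys (t + m) \<inter> {Suc 0, Suc k} \<noteq> {} \<or> divisible_by_pair (smaller_pairs i j) (t + m)"
  proof cases
    case 1
    then show ?thesis by (auto simp: keys_add_nat)
  next
    case 2
    let ?m' = "m - Poly_Mapping.single l 1"
    have m: "m = Poly_Mapping.single l 1 + ?m'"
      using 2(1) by (intro poly_mapping_eqI) (auto simp: lookup_add lookup_minus lookup_single when_def in_keys_iff)
    have "t + m = Poly_Mapping.single (min i l) 1 + Poly_Mapping.single (max i l) 1 +
        (Poly_Mapping.single j 1 + ?m')"
      by (subst m) (simp add: t_def min_def max_def ac_simps)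
    moreover have "t + m = Poly_Mapping.single l 1 + Poly_Mapping.single j 1 + (Poly_Mapping.single i 1 + ?m')"
      by (subst m) (simp add: t_def ac_simps)
    moreover have "(min i l, max i l) \<in> smaller_pairs i j \<or> (l, j) \<in> smaller_pairs i j"
      using 2 ij by (auto simp: smaller_pairs_def)
    ultimately show ?thesis unfolding divisible_by_pair_def by blast
  qed
qed

text \<open>Modulo the parameters, \<open>x\<^sub>i x\<^sub>j\<close> may be replaced by the element \<open>g\<close> of the ideal from
  \<open>curve_binomial\<close>; this reduces the colon ideal of \<open>g\<close> to that of a monomial.\<close>

lemma generated_pair_part_insert:
  assumes ij: "2 \<le> i" "i \<le> j" "j \<le> k"
    and IH: "generated_with_linear_quotients 2 (pair_part (smaller_pairs i j) :: (nat \<Rightarrow> 'k::field mpol) set)"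
  shows "generated_with_linear_quotients 2 (pair_part (insert (i, j) (smaller_pairs i j)) :: (nat \<Rightarrow> 'k mpol) set)"
proof -
  let ?E = "smaller_pairs i j" and ?t = "Poly_Mapping.single i 1 + Poly_Mapping.single j 1 :: nat \<Rightarrow>\<^sub>0 nat"
  let ?V = "{Suc 0, Suc k} \<union> {2..<j}"
  let ?x = "Poly_Mapping.single ?t 1 :: 'k mpol"
  obtain g :: "'k mpol" where g: "g \<in> curve_ideal k" "g \<in> homogeneous_polys (Suc k) 2"
    "var i * var j - g \<in> parameter_ideal" using curve_binomial[OF ij] by blast
  have x: "var i * var j = ?x" by (simp add: var_def mult_single)
  have x_R: "?x \<in> poly_ring (Suc k)" using ij by (simp add: poly_ring_def keys_add_nat)
  have xg: "?x - g \<in> parameter_ideal" using g(3) x by simp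
  define h :: "nat \<Rightarrow> 'k mpol" where "h l = (if l = 0 then g else 0)" for l
  have h_I: "h \<in> ideal_module (curve_ideal k)" using g(1) by (simp add: h_def ideal_module_def)
  \<comment> \<open>the colon ideal of the monomial \<open>x\<^sub>i x\<^sub>j\<close>\<close>
  have shift: "?x * r \<in> pair_ideal ?E \<longleftrightarrow> r \<in> variable_ideal (Suc k) ?V" if r: "r \<in> poly_ring (Suc k)" for r
  proof -
    have "?x * r \<in> poly_ring (Suc k)" using x_R r by (rule poly_ring_mult)
    moreover have "Poly_Mapping.keys m \<subseteq> {1..Suc k}" if "m \<in> Poly_Mapping.keys r" for m
      using r that by (simp add: poly_ring_def)
    ultimately show ?thesis
      using r pair_colon[OF ij] unfolding pair_ideal_def variable_ideal_def monomial_span_def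
      by (simp add: keys_mult_monomial)
  qed
  \<comment> \<open>the colon ideal is the same for \<open>g\<close>\<close>
  have rg: "r * g \<in> pair_ideal ?E \<longleftrightarrow> ?x * r \<in> pair_ideal ?E" if "r \<in> poly_ring (Suc k)" for r
  proof -
    have d: "r * (?x - g) \<in> pair_ideal ?E"
      using that xg by (intro parameter_ideal_pair_ideal variable_ideal_mult)
    have "r * g = ?x * r - r * (?x - g)" "?x * r = r * g + r * (?x - g)" by (simp_all add: algebra_simps)
    then show ?thesis using pair_ideal_add[OF _ d] pair_ideal_diff[OF _ d] by metis
  qed
  show ?thesis
  proof (rule generated_with_linear_quotients_extend[where h = h and V = ?V, OF IH poly_submodule_pair_part])
    show "pair_part ?E \<subseteq> (pair_part (insert (i, j) ?E) :: (nat \<Rightarrow> 'k mpol) set)"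
      unfolding pair_part_def pair_ideal_def divisible_by_pair_def by (auto elim!: monomial_span_mono)
    have "?x \<in> pair_ideal (insert (i, j) ?E)"
      unfolding pair_ideal_def using ij
      by (intro single_in_monomial_span) (auto simp: keys_add_nat divisible_by_pair_def intro!: exI[of _ 0])
    then have "?x - (?x - g) \<in> pair_ideal (insert (i, j) ?E)"
      by (rule pair_ideal_diff) (rule parameter_ideal_pair_ideal[OF xg])
    then show "h \<in> pair_part (insert (i, j) ?E)" using h_I by (simp add: pair_part_def h_def)
    show "h l \<in> homogeneous_polys (Suc k) 2" for l
      using g(2) by (simp add: h_def homogeneous_polys_def)
    show "{Suc 0, Suc k} \<subseteq> ?V" "?V \<subseteq> {1..Suc k}" using ij by auto
    show "(\<lambda>l. r * h l) \<in> pair_part ?E" if r: "r \<in> variable_ideal (Suc k) ?V" for r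
    proof -
      have r_R: "r \<in> poly_ring (Suc k)" using r by (rule variable_ideal_poly_ring)
      then have "r * h 0 \<in> pair_ideal ?E" using r rg shift by (simp add: h_def)
      then show ?thesis
        using poly_submodule_mult[OF poly_submodule_ideal_module h_I r_R] by (simp add: pair_part_def)
    qed
    show "r \<in> variable_ideal (Suc k) ?V"
      if r: "r \<in> poly_ring (Suc k)" and s: "s \<in> pair_part ?E" "param_congruent (\<lambda>l. r * h l) s" for r s
    proof -
      have "r * g - s 0 \<in> parameter_ideal" 
        using s(2)[unfolded param_congruent_def, rule_format, of 0] by (simp add: h_def)
      moreover have "s 0 \<in> pair_ideal ?E" using s(1) by (simp add: pair_part_def)
      ultimately have "(r * g - s 0) + s 0 \<in> pair_ideal ?E"
        using pair_ideal_add[OF parameter_ideal_pair_ideal] by blast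
      then show ?thesis using rg[OF r] shift[OF r] by simp
    qed
    show "\<exists>r\<in>poly_ring (Suc k). (\<lambda>l. s l - r * h l) \<in> pair_part ?E"
      if s: "s \<in> pair_part (insert (i, j) ?E)" for s
    proof -
      let ?P = "\<lambda>m. Poly_Mapping.keys m \<inter> {Suc 0, Suc k} \<noteq> {} \<or> divisible_by_pair ?E m"
      let ?a = "restrict_monomials ?P (s 0)" and ?b = "restrict_monomials (\<lambda>m. \<not> ?P m) (s 0)"
      have s0: "s 0 \<in> pair_ideal (insert (i, j) ?E)" "s \<in> ideal_module (curve_ideal k)"
        using s by (simp_all add: pair_part_def)
      have R: "?a \<in> poly_ring (Suc k)" "?b \<in> poly_ring (Suc k)"
        using s0(1) unfolding pair_ideal_def
        by (intro poly_ring_restrict monomial_span_poly_ring, assumption)+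
      have "\<exists>m'. m = ?t + m'" if "m \<in> Poly_Mapping.keys ?b" for m
      proof -
        have "m \<in> Poly_Mapping.keys (s 0)" "\<not> ?P m" using that by (auto simp: keys_restrict_monomials)
        then show ?thesis
          using s0(1) unfolding pair_ideal_def monomial_span_def divisible_by_pair_insert by blast
      qed
      then obtain r where r: "r \<in> poly_ring (Suc k)" "?b = ?x * r"
        using divide_by_monomial[of ?b "Suc k" "\<lambda>_. True" ?t] R(2)
        unfolding poly_ring_eq_monomial_span by blast
      have "?a \<in> pair_ideal ?E"
        using R(1) by (simp add: pair_ideal_def monomial_span_def keys_restrict_monomials)
      moreover have "r * (?x - g) \<in> pair_ideal ?E"
        using r(1) xg by (intro parameter_ideal_pair_ideal variable_ideal_mult)
      ultimately have "?a + r * (?x - g) \<in> pair_ideal ?E" by (rule pair_ideal_add)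
      moreover have "s 0 - r * g = ?a + r * (?x - g)"
        using restrict_monomials_split[of "s 0" ?P] r(2) by (simp add: algebra_simps)
      ultimately have "s 0 - r * h 0 \<in> pair_ideal ?E" by (simp add: h_def)
      then show ?thesis
        using poly_submodule_diff[OF poly_submodule_ideal_module s0(2)
            poly_submodule_mult[OF poly_submodule_ideal_module h_I r(1)]] r(1)
        by (intro bexI[of _ r]) (simp_all add: pair_part_def)
    qed
  qed
qed

lemma generated_pair_part:
  assumes "j \<le> Suc k" "2 \<le> j"
  shows "generated_with_linear_quotients 2 (pair_part (smaller_pairs 2 j) :: (nat \<Rightarrow> 'k::field mpol) set)"
  using assms(2,1)
proof (induction j rule: dec_induct)
  case base
  have no_pairs: "smaller_pairs 2 2 = {}" by (auto simp: smaller_pairs_def)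
  have no_pairs_ideal: "pair_ideal {} = (parameter_ideal :: 'k mpol set)"
    by (simp add: pair_ideal_def variable_ideal_def divisible_by_pair_def)
  have "param_congruent s (\<lambda>_. 0)" if "s \<in> pair_part (smaller_pairs 2 2)" for s :: "nat \<Rightarrow> 'k mpol"
    unfolding param_congruent_def
  proof
    fix l
    show "s l - 0 \<in> parameter_ideal"
      using that
      by (cases "l = 0") (simp_all add: pair_part_def ideal_module_def no_pairs no_pairs_ideal)
  qed
  moreover have "(\<lambda>_. 0) \<in> poly_span (Suc k) {..<0} h" for h :: "nat \<Rightarrow> nat \<Rightarrow> 'k mpol"
    by (rule poly_spanI[of _ "\<lambda>_. 0"]) auto
  ultimately show ?case
    unfolding generated_with_linear_quotients_def linear_quotients_def
    by (intro exI[of _ 0]) auto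
next
  case (step j)
  have "generated_with_linear_quotients 2 (pair_part (smaller_pairs i j) :: (nat \<Rightarrow> 'k mpol) set)"
    if "2 \<le> i" "i \<le> Suc j" for i
    using that
  proof (induction i rule: dec_induct)
    case base
    then show ?case using step by simp
  next
    case (step i)
    have "insert (i, j) (smaller_pairs i j) = smaller_pairs (Suc i) j"
      using step \<open>2 \<le> j\<close> by (auto simp: smaller_pairs_def less_Suc_eq)
    then show ?case
      using generated_pair_part_insert[of i j] step \<open>Suc j \<le> Suc k\<close> by simp
  qed
  from this[of "Suc j"] have "generated_with_linear_quotients 2
      (pair_part (smaller_pairs (Suc j) j) :: (nat \<Rightarrow> 'k mpol) set)" using step by simp
  moreover have "smaller_pairs (Suc j) j = smaller_pairs 2 (Suc j)"
    by (auto simp: smaller_pairs_def)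
  ultimately show ?case by simp
qed

text \<open>A monomial of degree at least two that avoids both parameters is divisible by a product of
  two inner variables, and the ideal has no monomials of smaller degree.\<close>

lemma pair_part_all:
  "pair_part (smaller_pairs 2 (Suc k)) = (ideal_module (curve_ideal k) :: (nat \<Rightarrow> 'k::field mpol) set)"
proof
  show "ideal_module (curve_ideal k) \<subseteq> (pair_part (smaller_pairs 2 (Suc k)) :: (nat \<Rightarrow> 'k mpol) set)"
  proof
    fix v :: "nat \<Rightarrow> 'k mpol" assume v: "v \<in> ideal_module (curve_ideal k)"
    then have v0: "v 0 \<in> curve_ideal k" by (simp add: ideal_module_def)
    have "divisible_by_pair (smaller_pairs 2 (Suc k)) m"
      if m: "m \<in> Poly_Mapping.keys (v 0)" and W: "Poly_Mapping.keys m \<inter> {Suc 0, Suc k} = {}" for m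
    proof -
      have deg: "mono_deg m \<ge> 2" using curve_ideal_degree_ge_2[OF v0 m] .
      have keys: "Poly_Mapping.keys m \<subseteq> {1..Suc k}"
        using curve_idealD(1)[OF v0] m by (simp add: poly_ring_def)
      have range: "2 \<le> i \<and> i \<le> k" if "i \<in> Poly_Mapping.keys m" for i
      proof -
        have "i \<in> {1..Suc k}" "i \<noteq> Suc 0" "i \<noteq> Suc k" using keys W that by auto
        then show ?thesis by auto
      qed
      have rest: "m = Poly_Mapping.single i 1 + (m - Poly_Mapping.single i 1)"
        if "i \<in> Poly_Mapping.keys m" for i and m :: "nat \<Rightarrow>\<^sub>0 nat"
        using that by (intro poly_mapping_eqI) (auto simp: lookup_add lookup_minus lookup_single when_def in_keys_iff)
      obtain i where i: "i \<in> Poly_Mapping.keys m"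
        using deg by (metis ex_in_conv keys_eq_empty mono_deg_0 not_numeral_le_zero)
      define m1 where "m1 = m - Poly_Mapping.single i 1"
      have m1: "m = Poly_Mapping.single i 1 + m1" using rest[OF i] by (simp add: m1_def)
      then have "mono_deg m1 \<noteq> 0" using deg by (auto simp: mono_deg_add)
      then obtain j where j: "j \<in> Poly_Mapping.keys m1"
        by (metis ex_in_conv keys_eq_empty mono_deg_0)
      define m2 where "m2 = m1 - Poly_Mapping.single j 1"
      have m2: "m1 = Poly_Mapping.single j 1 + m2" using rest[OF j] by (simp add: m2_def)
      have j_m: "j \<in> Poly_Mapping.keys m" using j m1 by (simp add: keys_add_nat)
      have "m = Poly_Mapping.single (min i j) 1 + Poly_Mapping.single (max i j) 1 + m2"
        unfolding m1 m2 by (simp add: min_def max_def ac_simps)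
      moreover have "(min i j, max i j) \<in> smaller_pairs 2 (Suc k)"
        using range[OF i] range[OF j_m] by (auto simp: smaller_pairs_def)
      ultimately show ?thesis unfolding divisible_by_pair_def by blast
    qed
    then have "v 0 \<in> pair_ideal (smaller_pairs 2 (Suc k))"
      using curve_idealD(1)[OF v0] by (auto simp: pair_ideal_def monomial_span_def)
    with v show "v \<in> pair_part (smaller_pairs 2 (Suc k))" by (simp add: pair_part_def)
  qed
qed (simp add: pair_part_def)

lemma linear_module_curve_ideal:
  "linear_module 2 (ideal_module (curve_ideal k) :: (nat \<Rightarrow> 'k::field mpol) set)"
proof (rule nakayama_homogeneous[OF poly_submodule_ideal_module parameters_regular_curve_ideal])
  show "generated_with_linear_quotients 2 (ideal_module (curve_ideal k) :: (nat \<Rightarrow> 'k mpol) set)"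
    using generated_pair_part[of "Suc k"] k_ge_2 by (simp add: pair_part_all)
  fix v :: "nat \<Rightarrow> 'k mpol" assume v: "v \<in> ideal_module (curve_ideal k)"
  obtain N where "degree_part {..<N} (v 0) = v 0" using degree_part_large[of "{0}" v] by auto
  then have "\<forall>l. degree_part {..<N} (v l) = v l"
    using v unfolding ideal_module_def by (metis (mono_tags, lifting) degree_part_0 gr0I mem_Collect_eq)
  then show "\<exists>N. \<forall>l. degree_part {..<N} (v l) = v l" ..
qed

lemma curve_ideal_nonzero: "ideal_module (curve_ideal k :: 'k::field mpol set) \<noteq> {\<lambda>_. 0}"
proof -
  obtain g :: "'k mpol" where g: "g \<in> curve_ideal k" "var 2 * var 2 - g \<in> parameter_ideal"
    using curve_binomial[of 2 2] k_ge_2 by auto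
  have "g \<noteq> 0"
  proof
    assume "g = 0"
    then show False
      using g(2) k_ge_2 by (auto simp: var_def mult_single variable_ideal_def monomial_span_def keys_add_nat)
  qed
  have "(\<lambda>l. if l = 0 then g else 0) \<in> ideal_module (curve_ideal k)"
    using g(1) by (simp add: ideal_module_def)
  moreover have "(\<lambda>l. if l = 0 then g else 0) \<noteq> (\<lambda>_::nat. 0)"
    using \<open>g \<noteq> 0\<close> by (auto dest: fun_cong[of _ _ 0])
  ultimately show ?thesis by blast
qed

lemma regularity_curve_ideal: "regularity (Suc k) (curve_ideal k) = 2"
  using linear_ideal_regularity[OF linear_module_curve_ideal _ curve_ideal_nonzero] k_ge_2 by simp

end

section \<open>Semigroups generated by arithmetic sequences\<close>

lemma single_power_nat:
  fixes v :: "nat ^ 'r"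
  shows "Poly_Mapping.single v (1::'k::field) ^ c = Poly_Mapping.single (c *s v) 1"
proof (induction c)
  case 0
  have "0 *s v = (0 :: nat ^ 'r)" by (simp add: vec_eq_iff)
  then show ?case by simp
next
  case (Suc c)
  have "Suc c *s v = v + c *s v" by (simp add: vec_eq_iff)
  then show ?case by (simp add: Suc mult_single)
qed

lemma prod_single_nat:
  fixes v :: "nat \<Rightarrow> nat ^ 'r"
  assumes "finite A"
  shows "(\<Prod>i\<in>A. Poly_Mapping.single (v i) (1::'k::field)) = Poly_Mapping.single (\<Sum>i\<in>A. v i) 1"
  using assms by (induction A rule: finite_induct) (auto simp: mult_single)

lemma monomial_image:
  fixes a d :: "nat ^ 'r"
  shows "(\<Prod>i\<in>Poly_Mapping.keys m. Poly_Mapping.single (a + (i - 1) *s d) (1::'k::field) ^ Poly_Mapping.lookup m i) =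
    Poly_Mapping.single (mono_deg m *s a + weight m *s d) 1"
proof -
  have "(\<Sum>i\<in>Poly_Mapping.keys m. Poly_Mapping.lookup m i *s (a + (i - 1) *s d)) = mono_deg m *s a + weight m *s d"
    by (simp add: vec_eq_iff mono_deg_def weight_def sum_distrib_right distrib_left sum.distrib mult.assoc)
  then show ?thesis by (simp add: single_power_nat prod_single_nat)
qed

lemma degree_weight_injective:
  fixes a d :: "nat ^ 'r"
  assumes indep: "lin_indep_over_rat a d" and eq: "D *s a + w *s d = D' *s a + w' *s d"
  shows "D = D' \<and> w = w'"
proof -
  have ne: "rat_vec a \<noteq> rat_vec d"
    using indep by (auto simp: lin_indep_over_rat_def rat_vec_def vec_eq_iff)
  have eq': "D * a $ i + w * d $ i = D' * a $ i + w' * d $ i" for i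
    using arg_cong[OF eq, of "\<lambda>v. v $ i"] by simp
  define u :: "rat ^ 'r \<Rightarrow> rat" where
    "u v = (if v = rat_vec a then of_nat D - of_nat D' else of_nat w - of_nat w')" for v
  have "(\<Sum>v\<in>{rat_vec a, rat_vec d}. u v *s v) = 0"
  proof -
    have "(of_nat D - of_nat D' :: rat) * of_nat (a $ i) + (of_nat w - of_nat w') * of_nat (d $ i) = 0" for i
      using arg_cong[OF eq'[of i], of "of_nat :: nat \<Rightarrow> rat"] by (simp add: algebra_simps)
    then have "(of_nat D - of_nat D') *s rat_vec a + (of_nat w - of_nat w') *s rat_vec d = 0"
      unfolding rat_vec_def by (simp add: vec_eq_iff left_diff_distrib)
    then show ?thesis using ne ne[symmetric] by (simp add: u_def)
  qed
  then have "u v = 0" if "v \<in> {rat_vec a, rat_vec d}" for v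
    using indep that vec.independentD[of "{rat_vec a, rat_vec d}" "{rat_vec a, rat_vec d}" u v]
    by (auto simp: lin_indep_over_rat_def)
  from this[of "rat_vec a"] this[of "rat_vec d"] show ?thesis using ne by (auto simp: u_def)
qed

text \<open>Linear independence of \<open>a\<close> and \<open>d\<close> makes the exponent \<open>D a + w d\<close> determine \<open>D\<close> and
  \<open>w\<close>, so the defining ideal does not depend on \<open>a\<close> and \<open>d\<close>.\<close>

lemma defining_ideal_eq_curve_ideal:
  fixes a d :: "nat ^ 'r"
  assumes "lin_indep_over_rat a d"
  shows "defining_ideal a d k = (curve_ideal k :: 'k::field mpol set)"
proof -
  let ?f = "\<lambda>i. Poly_Mapping.single (a + (i - 1) *s d) (1 :: 'k)"
  let ?\<phi> = "\<lambda>m. mono_deg m *s a + weight m *s d"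
  have lookup: "Poly_Mapping.lookup (poly_subst ?f p) s =
      (\<Sum>m\<in>Poly_Mapping.keys p. if ?\<phi> m = s then Poly_Mapping.lookup p m else 0)" for p :: "'k mpol" and s
    unfolding poly_subst_def monomial_image lookup_sum
    by (intro sum.cong refl) (simp add: mult_single lookup_single when_def)
  have "Poly_Mapping.lookup (poly_subst ?f p) (D *s a + w *s d) = class_sum p D w" for p :: "'k mpol" and D w
    unfolding lookup class_sum_def
    by (intro sum.cong refl) (auto dest: degree_weight_injective[OF assms])
  moreover have "Poly_Mapping.lookup (poly_subst ?f p) s = 0"
    if "\<forall>D w. s \<noteq> D *s a + w *s d" for p :: "'k mpol" and s
    unfolding lookup using that by (intro sum.neutral) metis
  ultimately have "poly_subst ?f p = 0 \<longleftrightarrow> (\<forall>D w. class_sum p D w = 0)" for p :: "'k mpol"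
    by (metis lookup_zero poly_mapping_eqI)
  then show ?thesis by (simp add: defining_ideal_def curve_ideal_def)
qed

theorem theorem6p3:
  fixes a d :: "nat ^ 2" and k :: nat
  assumes "k \<ge> 2"
    and "lin_indep_over_rat a d"
    and "minimal_generating_set (arith_gens a d k) (arith_semigroup a d k)"
  shows "regularity (k + 1) (defining_ideal a d k :: 'k::field mpol set) = 2"
proof -
  interpret rational_normal_curve k by unfold_locales (rule assms(1))
  show ?thesis
    using regularity_curve_ideal by (simp add: defining_ideal_eq_curve_ideal[OF assms(2)])
qed

end
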